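(* Let $G$ be a unicyclic graph on $n$ vertices whose unique cycle has length $q$. Let $C_n$ be the cycle on $n$ vertices and let $G_{(2)}$ be the graph on $n$ vertices obtained from the cycle $C_{n-1}$ by attaching one pendent vertex to one of its vertices. If $q<n$, then $$SLEE(C_n)<SLEE(G_{(2)})\le SLEE(G),$$ with equality in the right inequality if and only if $G\cong G_{(2)}$ (i.e. $q=n-1$).
   Context: All graphs are simple, finite and undirected. For a graph $G$ on $n$ vertices, the signless Laplacian matrix is $Q=D+A$, where $A$ is the adjacency matrix and $D$ is the diagonal matrix of vertex degrees. If $q_1,\dots,q_n$ are the eigenvalues of $Q$ (with multiplicity), the signless Laplacian Estrada index is $SLEE(G)=\sum_{i=1}^n e^{q_i}$. A unicyclic graph is a connected graph with the same number of vertices and edges (equivalently, a connected graph with a unique cycle). A pendent vertex is a vertex of degree 1. *)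

theory Defs
  imports
    "Graph_Theory.Graph_Theory"
    "Jordan_Normal_Form.Char_Poly"
begin

text \<open>
  A simple finite undirected graph is a \<^locale>\<open>pair_graph\<close>: a finite, loop-free, symmetric
  digraph without parallel arcs. Each undirected edge corresponds to a pair of opposite arcs, so
  the degree of a vertex is its out-degree.
\<close>

definition edges :: "'a pair_pre_digraph \<Rightarrow> 'a set set" where
  "edges G = (\<lambda>(u, v). {u, v}) ` parcs G"

text \<open>The constant \<open>connected\<close> must be qualified because of topological connectedness.\<close>

definition unicyclic :: "'a pair_pre_digraph \<Rightarrow> bool" where
  "unicyclic G \<longleftrightarrow>
     pair_graph G \<and> Digraph_Component.connected (with_proj G) \<and> card (edges G) = card (pverts G)"

text \<open>
  In a symmetric digraph an arc followed by its reverse satisfies \<^const>\<open>pre_digraph.cycle\<close>;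
  the cycles of the undirected graph are those of length at least 3.
\<close>

definition has_cycle_of_length :: "'a pair_pre_digraph \<Rightarrow> nat \<Rightarrow> bool" where
  "has_cycle_of_length G k \<longleftrightarrow> 3 \<le> k \<and> (\<exists>p. pre_digraph.cycle (with_proj G) p \<and> length p = k)"

definition graph_iso :: "'a pair_pre_digraph \<Rightarrow> 'b pair_pre_digraph \<Rightarrow> bool" where
  "graph_iso G H \<longleftrightarrow> digraph_iso (with_proj G) (with_proj H)"

text \<open>Matrices with rows and columns indexed along an enumeration \<open>vs\<close> of the vertices.\<close>

definition adjacency_mat :: "'a pair_pre_digraph \<Rightarrow> 'a list \<Rightarrow> real mat" where
  "adjacency_mat G vs =
     mat (length vs) (length vs) (\<lambda>(i, j). if (vs ! i, vs ! j) \<in> parcs G then 1 else 0)"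

definition degree_mat :: "'a pair_pre_digraph \<Rightarrow> 'a list \<Rightarrow> real mat" where
  "degree_mat G vs =
     mat_diag (length vs) (\<lambda>i. real (out_degree (with_proj G) (vs ! i)))"

definition signless_laplacian :: "'a pair_pre_digraph \<Rightarrow> 'a list \<Rightarrow> real mat" where
  "signless_laplacian G vs = degree_mat G vs + adjacency_mat G vs"

text \<open>
  The multiset of real roots of the characteristic polynomial contains all eigenvalues with
  multiplicity, since the matrix is real symmetric. It does not depend on the chosen enumeration,
  since a different one yields a matrix that is similar via a permutation matrix.
\<close>

definition signless_spectrum :: "'a pair_pre_digraph \<Rightarrow> real multiset" where
  "signless_spectrum G =
     proots (char_poly (signless_laplacian G (SOME vs. distinct vs \<and> set vs = pverts G)))"

definition SLEE :: "'a pair_pre_digraph \<Rightarrow> real" where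
  "SLEE G = (\<Sum>x\<in>#signless_spectrum G. exp x)"

text \<open>The cycle on \<open>m\<close> vertices, for \<open>m \<ge> 3\<close>.\<close>

definition cycle_graph :: "nat \<Rightarrow> nat pair_pre_digraph" where
  "cycle_graph m =
     \<lparr> pverts = {..<m},
       parcs = {(i, j). i < m \<and> j < m \<and> (j = Suc i mod m \<or> i = Suc j mod m)} \<rparr>"

definition attach_pendent :: "'a pair_pre_digraph \<Rightarrow> 'a \<Rightarrow> 'a \<Rightarrow> 'a pair_pre_digraph" where
  "attach_pendent G u w =
     \<lparr> pverts = insert w (pverts G), parcs = parcs G \<union> {(u, w), (w, u)} \<rparr>"

text \<open>By symmetry of the cycle, the choice of the vertex \<open>0\<close> is immaterial.\<close>

definition pendent_cycle_graph :: "nat \<Rightarrow> nat pair_pre_digraph" where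
  "pendent_cycle_graph n = attach_pendent (cycle_graph (n - 1)) 0 (n - 1)"

end

theory Submission
  imports Defs "Jordan_Normal_Form.Schur_Decomposition"
begin

text \<open>
  Since the signless Laplacian \<open>Q\<close> is real symmetric, \<open>SLEE G = (\<Sum>k. tr Q\<^sup>k / k!)\<close>, so one graph has
  a smaller index than another as soon as no spectral moment \<open>tr Q\<^sup>k\<close> is larger and one is smaller
  (\<open>SLEE_sums\<close>, \<open>sums_less\<close>). Adding an edge \<open>xw\<close> to a graph \<open>K\<close> adds to its \<open>Q\<close> the rank-one
  operator \<open>b b\<^sup>T\<close> with \<open>b = e\<^sub>x + e\<^sub>w\<close>, and the moments of \<open>Q + b b\<^sup>T\<close> are monotone in the
  numbers \<open>b\<^sup>T Q\<^sup>j b\<close> (\<open>moment_rank_one_update_mono\<close>). Two ways of adding one edge to \<open>K\<close> can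
  therefore be compared inside \<open>K\<close>.

  Let \<open>p 0, \<dots>, p m\<close> be a path in \<open>K\<close> with inner vertices of degree 2 and with leaf \<open>p m\<close>, while
  \<open>p 0\<close> has a neighbour off the path, and let \<open>w\<close> lie off the path. For \<open>2 * i < m\<close>, joining \<open>w\<close> to
  the far vertex \<open>p (m - i)\<close> gives a smaller index than joining it to \<open>p i\<close> (\<open>SLEE_slide\<close>). The
  two values of \<open>b\<^sup>T Q\<^sup>j b\<close> differ by \<open>h (p i) - h (p (m - i))\<close>, where \<open>h = Q\<^sup>j c\<close> and
  \<open>c = e\<^bsub>p i\<^esub> + e\<^bsub>p (m - i)\<^esub> + 2 e\<^sub>w\<close> is symmetric under reversal of the path. The cone of
  nonnegative functions that are at least as large on the near half of the path as at the mirror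
  images is invariant under \<open>Q\<close>, because \<open>p 0\<close> receives contributions from off the path and \<open>p m\<close>
  receives none.

  Every unicyclic graph with a leaf is pushed to a cycle with one pendent vertex by such slides. A
  leaf ends a pendant path starting at a vertex \<open>x\<close> of degree at least 3 (\<open>leaf_pendant_path\<close>). If there is a second leaf, an
  edge at \<open>x\<close> is moved to the end of the path, which is the case \<open>i = 0\<close> (\<open>reduce_two_leaves\<close>). If
  there is one leaf and it is not adjacent to \<open>x\<close>, one of the two cycle edges at \<open>x\<close> is moved
  along the path extended backwards by the other one, which is the case \<open>i = 1\<close>; all but the last
  edge of the path is absorbed into the cycle (\<open>reduce_one_leaf\<close>). Both moves keep the graph
  unicyclic with a leaf, so a graph of least index among the finitely many such graphs on the same
  vertices admits neither move, and it is a cycle with one pendent vertex (\<open>descend\<close>); a graph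
  admitting a move has strictly larger index. A unicyclic graph with \<open>q < n\<close> has a leaf since
  otherwise it would be 2-regular and equal to its cycle (\<open>short_cycle_has_leaf\<close>). Finally
  the cycle \<open>C\<^sub>n\<close> arises from \<open>C\<^bsub>n - 1\<^esub>\<close> with a pendent vertex by a single slide along the pendent
  edge (\<open>SLEE_cycle_graph_less\<close>).
\<close>

section \<open>Power sums of the eigenvalues of a symmetric matrix\<close>

lemma symmetric_mat_eigenvalue_Im:
  fixes A :: "real mat" and a :: complex
  assumes A: "A \<in> carrier_mat n n"
    and sym: "\<And>i j. i < n \<Longrightarrow> j < n \<Longrightarrow> A $$ (i, j) = A $$ (j, i)"
    and ev: "eigenvalue (map_mat of_real A) a"
  shows "Im a = 0"
proof -
  obtain v where v: "v \<in> carrier_vec n" "v \<noteq> 0\<^sub>v n"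
    and Av: "map_mat of_real A *\<^sub>v v = a \<cdot>\<^sub>v v"
    using ev A unfolding eigenvalue_def eigenvector_def by auto
  have row: "(\<Sum>j<n. of_real (A $$ (i, j)) * v $ j) = a * v $ i" if "i < n" for i
  proof -
    have "(\<Sum>j<n. of_real (A $$ (i, j)) * v $ j) = (map_mat of_real A *\<^sub>v v) $ i"
      using that A v by (auto simp: scalar_prod_def lessThan_atLeast0 intro!: sum.cong)
    also have "\<dots> = a * v $ i" using Av that v by auto
    finally show ?thesis .
  qed
  define N where "N = (\<Sum>i<n. (cmod (v $ i))\<^sup>2)"
  \<comment> \<open>The Hermitian form \<open>v\<^sup>* A v\<close> equals its own conjugate, and it equals \<open>a * N\<close>.\<close>
  define S where "S = (\<Sum>i<n. \<Sum>j<n. cnj (v $ i) * of_real (A $$ (i, j)) * v $ j)"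
  have "S = (\<Sum>i<n. cnj (v $ i) * (\<Sum>j<n. of_real (A $$ (i, j)) * v $ j))"
    unfolding S_def by (simp add: sum_distrib_left mult.assoc)
  also have "\<dots> = (\<Sum>i<n. a * of_real ((cmod (v $ i))\<^sup>2))"
    by (intro sum.cong refl, subst row) (simp_all add: complex_norm_square mult_ac del: of_real_power)
  also have "\<dots> = a * of_real N" by (simp add: N_def sum_distrib_left)
  finally have S: "S = a * of_real N" .
  have "cnj S = (\<Sum>i<n. \<Sum>j<n. v $ i * of_real (A $$ (i, j)) * cnj (v $ j))"
    unfolding S_def by simp
  also have "\<dots> = (\<Sum>j<n. \<Sum>i<n. v $ i * of_real (A $$ (i, j)) * cnj (v $ j))"
    by (rule sum.swap)
  also have "\<dots> = S"
    unfolding S_def by (intro sum.cong refl) (simp add: sym mult_ac)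
  finally have "cnj S = S" .
  then have "Im S = 0" by (simp add: complex_eq_iff)
  then have *: "Im a * N = 0" using S by simp
  obtain i where "i < n" "v $ i \<noteq> 0"
    using v by (metis carrier_vecD eq_vecI index_zero_vec(1) index_zero_vec(2))
  then have "0 < N" unfolding N_def by (intro sum_pos2[of _ i]) auto
  with * show ?thesis by simp
qed

lemma symmetric_mat_char_poly_splits:
  fixes A :: "real mat"
  assumes A: "A \<in> carrier_mat n n"
    and sym: "\<And>i j. i < n \<Longrightarrow> j < n \<Longrightarrow> A $$ (i, j) = A $$ (j, i)"
  obtains es where "char_poly A = (\<Prod>a\<leftarrow>es. [:- a, 1:])"
proof -
  let ?C = "map_mat of_real A :: complex mat"
  interpret P: map_poly_inj_comm_ring_hom "of_real :: real \<Rightarrow> complex" ..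
  have C: "?C \<in> carrier_mat n n" using A by simp
  obtain as where as: "char_poly ?C = (\<Prod>a\<leftarrow>as. [:- a, 1:])"
    using char_poly_factorized[OF C] by auto
  have "of_real (Re a) = a" if "a \<in> set as" for a
  proof -
    have "poly (char_poly ?C) a = 0"
      unfolding as poly_prod_list prod_list_zero_iff using that by force
    then have "Im a = 0"
      using symmetric_mat_eigenvalue_Im[OF A sym] eigenvalue_root_char_poly[OF C] by blast
    then show ?thesis by (simp add: complex_eq_iff)
  qed
  then have "map_poly of_real (\<Prod>a\<leftarrow>map Re as. [:- a, 1:]) = (\<Prod>a\<leftarrow>as. [:- a, 1:])"
    by (induction as) (simp_all add: P.hom_mult del: mult_pCons_left)
  also have "\<dots> = map_poly of_real (char_poly A)"
    using of_real_hom.char_poly_hom[OF A, where ?'a = complex] as by simp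
  finally show thesis using that[of "map Re as"] by (metis P.injectivity)
qed

lemma upper_triangular_pow_mat:
  fixes B :: "'a::comm_ring_1 mat"
  assumes B: "B \<in> carrier_mat n n" and ut: "upper_triangular B"
  shows "upper_triangular (B ^\<^sub>m k) \<and> (\<forall>i<n. (B ^\<^sub>m k) $$ (i, i) = (B $$ (i, i)) ^ k)"
proof (induction k)
  case 0
  then show ?case using B by auto
next
  case (Suc k)
  let ?P = "B ^\<^sub>m k"
  have P: "?P \<in> carrier_mat n n" using B by simp
  have entry: "(?P * B) $$ (i, j) = (\<Sum>l<n. ?P $$ (i, l) * B $$ (l, j))" if "i < n" "j < n" for i j
    using that B P by (simp add: scalar_prod_def lessThan_atLeast0)
  have zero: "?P $$ (i, l) * B $$ (l, j) = 0" if "i < n" "l < n" "l < i \<or> j < l" for i j l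
    using that Suc upper_triangularD[OF ut, of j l] upper_triangularD[of ?P l i] B P by fastforce
  have "(?P * B) $$ (i, j) = 0" if "j < i" "i < n" for i j
    using that by (subst entry, simp_all) (rule sum.neutral, auto intro!: zero)
  then have "upper_triangular (?P * B)" using B P by (intro upper_triangularI) auto
  moreover have "(?P * B) $$ (i, i) = (B $$ (i, i)) ^ Suc k" if i: "i < n" for i
  proof -
    have "(?P * B) $$ (i, i) = (\<Sum>l\<in>{i}. ?P $$ (i, l) * B $$ (l, i))"
      unfolding entry[OF i i] using i by (intro sum.mono_neutral_right) (auto intro!: zero)
    then show ?thesis using Suc i by (simp add: mult.commute)
  qed
  ultimately show ?case by simp
qed

lemma sum_diag_mult_commute:
  fixes X Y :: "'a::comm_ring_1 mat"
  assumes "X \<in> carrier_mat n n" "Y \<in> carrier_mat n n"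
  shows "(\<Sum>i<n. (X * Y) $$ (i, i)) = (\<Sum>i<n. (Y * X) $$ (i, i))"
proof -
  have "(\<Sum>i<n. (X * Y) $$ (i, i)) = (\<Sum>i<n. \<Sum>j<n. X $$ (i, j) * Y $$ (j, i))"
    using assms by (simp add: scalar_prod_def lessThan_atLeast0)
  also have "\<dots> = (\<Sum>j<n. \<Sum>i<n. Y $$ (j, i) * X $$ (i, j))"
    by (subst sum.swap) (simp add: mult.commute)
  also have "\<dots> = (\<Sum>i<n. (Y * X) $$ (i, i))"
    using assms by (simp add: scalar_prod_def lessThan_atLeast0)
  finally show ?thesis .
qed

text \<open>
  Over the reals a symmetric matrix is similar to an upper triangular one, whose diagonal lists the
  eigenvalues with multiplicity; the trace of a power is invariant under similarity.
\<close>

lemma symmetric_mat_power_sums: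
  fixes A :: "real mat"
  assumes A: "A \<in> carrier_mat n n"
    and sym: "\<And>i j. i < n \<Longrightarrow> j < n \<Longrightarrow> A $$ (i, j) = A $$ (j, i)"
  shows "(\<Sum>x\<in>#proots (char_poly A). x ^ k) = (\<Sum>i<n. (A ^\<^sub>m k) $$ (i, i))"
proof -
  obtain es where es: "char_poly A = (\<Prod>a\<leftarrow>es. [:- a, 1:])"
    using symmetric_mat_char_poly_splits[OF A sym] .
  obtain B where B: "B \<in> carrier_mat n n" and ut: "upper_triangular B" and sim: "similar_mat A B"
    using schur_decomposition_exists[OF A es] by blast
  have "proots (\<Prod>a\<leftarrow>ds. [:- a, 1:]) = mset ds" for ds :: "real list"
    by (induction ds) (simp_all add: proots_mult prod_list_zero_iff image_iff del: mult_pCons_left)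
  then have "proots (char_poly A) = mset (diag_mat B)"
    using char_poly_similar[OF sim] char_poly_upper_triangular[OF B ut] by simp
  then have "(\<Sum>x\<in>#proots (char_poly A). x ^ k) = (\<Sum>i<n. (B $$ (i, i)) ^ k)"
    using B by (simp add: diag_mat_def sum_mset_sum_list comp_def
        interv_sum_list_conv_sum_set_nat lessThan_atLeast0 flip: mset_map)
  also have "\<dots> = (\<Sum>i<n. (B ^\<^sub>m k) $$ (i, i))"
    using upper_triangular_pow_mat[OF B ut] by simp
  finally have diag: "(\<Sum>x\<in>#proots (char_poly A). x ^ k) = (\<Sum>i<n. (B ^\<^sub>m k) $$ (i, i))" .
  obtain P Q where PQ: "similar_mat_wit A B P Q" using sim unfolding similar_mat_def by auto
  have c: "P \<in> carrier_mat n n" "Q \<in> carrier_mat n n" "Q * P = 1\<^sub>m n"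
    using similar_mat_witD2[OF A PQ] by auto
  have Bk: "B ^\<^sub>m k \<in> carrier_mat n n" using B by simp
  have "(\<Sum>i<n. (A ^\<^sub>m k) $$ (i, i)) = (\<Sum>i<n. (P * B ^\<^sub>m k * Q) $$ (i, i))"
    using similar_mat_wit_pow_id[OF PQ] by simp
  also have "\<dots> = (\<Sum>i<n. (Q * (P * B ^\<^sub>m k)) $$ (i, i))"
    using c Bk by (intro sum_diag_mult_commute) auto
  also have "Q * (P * B ^\<^sub>m k) = B ^\<^sub>m k"
    using assoc_mult_mat[OF c(2,1) Bk] c(3) left_mult_one_mat[OF Bk] by simp
  finally show ?thesis using diag by simp
qed

lemma symmetric_mat_exp_sums:
  fixes A :: "real mat"
  assumes A: "A \<in> carrier_mat n n"
    and sym: "\<And>i j. i < n \<Longrightarrow> j < n \<Longrightarrow> A $$ (i, j) = A $$ (j, i)"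
  shows "(\<lambda>k. (\<Sum>i<n. (A ^\<^sub>m k) $$ (i, i)) / fact k) sums (\<Sum>x\<in>#proots (char_poly A). exp x)"
proof -
  have "(\<lambda>k. (\<Sum>x\<in>#M. x ^ k) / fact k) sums (\<Sum>x\<in>#M. exp x)" for M :: "real multiset"
  proof (induction M)
    case (add x M)
    have "(\<lambda>k. x ^ k / fact k) sums exp x"
      using exp_converges[of x] by (simp add: divide_inverse mult.commute)
    from sums_add[OF this add] show ?case by (simp add: add_divide_distrib)
  qed simp
  from this[of "proots (char_poly A)"] show ?thesis
    by (simp only: symmetric_mat_power_sums[OF A sym])
qed


section \<open>Self-adjoint operators and rank-one updates\<close>

definition dot :: "'a set \<Rightarrow> ('a \<Rightarrow> real) \<Rightarrow> ('a \<Rightarrow> real) \<Rightarrow> real" where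
  "dot V f g = (\<Sum>v\<in>V. f v * g v)"

text \<open>
  The trace of \<open>A ^^ k\<close> on the functions on \<open>V\<close>.
\<close>

definition moment :: "'a set \<Rightarrow> (('a \<Rightarrow> real) \<Rightarrow> 'a \<Rightarrow> real) \<Rightarrow> nat \<Rightarrow> real" where
  "moment V A k = (\<Sum>v\<in>V. (A ^^ k) (\<lambda>u. of_bool (u = v)) v)"

definition rank_one_update ::
    "'a set \<Rightarrow> (('a \<Rightarrow> real) \<Rightarrow> 'a \<Rightarrow> real) \<Rightarrow> ('a \<Rightarrow> real) \<Rightarrow> ('a \<Rightarrow> real) \<Rightarrow> 'a \<Rightarrow> real" where
  "rank_one_update V A b f = (\<lambda>u. A f u + dot V b f * b u)"

locale self_adjoint_op =
  fixes V :: "'a set" and A :: "('a \<Rightarrow> real) \<Rightarrow> 'a \<Rightarrow> real"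
  assumes finite_V: "finite V"
    and linear: "A (\<lambda>u. f u + c * g u) = (\<lambda>u. A f u + c * A g u)"
    and self_adjoint: "dot V f (A g) = dot V (A f) g"
begin

lemma linear_pow: "(A ^^ k) (\<lambda>u. f u + c * g u) = (\<lambda>u. (A ^^ k) f u + c * (A ^^ k) g u)"
  by (induction k) (simp_all add: linear)

lemma self_adjoint_pow: "dot V f ((A ^^ k) g) = dot V ((A ^^ k) f) g"
  by (induction k arbitrary: f g) (simp, simp add: self_adjoint funpow_swap1)

lemma dot_commute: "dot V f g = dot V g f"
  by (simp add: dot_def mult.commute)

lemma dot_add_right: "dot V f (\<lambda>u. g u + c * h u) = dot V f g + c * dot V f h"
  by (simp add: dot_def sum.distrib sum_distrib_left algebra_simps)

lemma dot_delta: "v \<in> V \<Longrightarrow> dot V f (\<lambda>u. of_bool (u = v)) = f v"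
  using finite_V by (simp add: dot_def)

lemma self_adjoint_op_rank_one_update: "self_adjoint_op V (rank_one_update V A b)"
proof
  show "rank_one_update V A b (\<lambda>u. f u + c * g u)
      = (\<lambda>u. rank_one_update V A b f u + c * rank_one_update V A b g u)" for f g c
    by (simp add: rank_one_update_def linear dot_add_right algebra_simps)
  show "dot V f (rank_one_update V A b g) = dot V (rank_one_update V A b f) g" for f g
    unfolding rank_one_update_def dot_add_right dot_commute[of _ g] self_adjoint
    by (simp add: dot_commute)
qed (rule finite_V)

text \<open>
  With \<open>M = A + b b\<^sup>T\<close>, the quantities \<open>b\<^sup>T A\<^sup>a M\<^sup>i b\<close> and below \<open>tr (A\<^sup>a M\<^sup>i)\<close> satisfy recursions
  that trade one factor \<open>M\<close> for a factor \<open>A\<close>. Only sums and products of the numbers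
  \<open>b\<^sup>T A\<^sup>j b\<close> enter besides \<open>tr A\<^sup>j\<close>.
\<close>

abbreviation mixed :: "('a \<Rightarrow> real) \<Rightarrow> nat \<Rightarrow> nat \<Rightarrow> real" where
  "mixed b a i \<equiv> dot V b ((A ^^ a) ((rank_one_update V A b ^^ i) b))"

lemma mixed_Suc: "mixed b a (Suc i) = mixed b (Suc a) i + mixed b 0 i * mixed b a 0"
proof -
  let ?g = "(rank_one_update V A b ^^ i) b"
  have "(A ^^ a) ((rank_one_update V A b ^^ Suc i) b)
      = (\<lambda>u. (A ^^ a) (A ?g) u + dot V b ?g * (A ^^ a) b u)"
    by (simp add: rank_one_update_def linear_pow)
  then show ?thesis by (simp add: dot_add_right funpow_swap1)
qed

abbreviation mixed_moment :: "('a \<Rightarrow> real) \<Rightarrow> nat \<Rightarrow> nat \<Rightarrow> real" where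
  "mixed_moment b a i \<equiv>
     \<Sum>v\<in>V. (A ^^ a) ((rank_one_update V A b ^^ i) (\<lambda>u. of_bool (u = v))) v"

lemma mixed_moment_Suc: "mixed_moment b a (Suc i) = mixed_moment b (Suc a) i + mixed b a i"
proof -
  interpret M: self_adjoint_op V "rank_one_update V A b"
    by (rule self_adjoint_op_rank_one_update)
  let ?M = "rank_one_update V A b" and ?d = "\<lambda>v u. of_bool (u = v) :: real"
  have "(A ^^ a) ((?M ^^ Suc i) (?d v)) v
      = (A ^^ Suc a) ((?M ^^ i) (?d v)) v + (?M ^^ i) b v * (A ^^ a) b v" if "v \<in> V" for v
  proof -
    have "(A ^^ a) ((?M ^^ Suc i) (?d v))
        = (\<lambda>u. (A ^^ a) (A ((?M ^^ i) (?d v))) u + dot V b ((?M ^^ i) (?d v)) * (A ^^ a) b u)"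
      by (simp add: rank_one_update_def linear_pow)
    then show ?thesis
      using that by (simp add: M.self_adjoint_pow dot_delta funpow_swap1)
  qed
  then have "mixed_moment b a (Suc i)
      = mixed_moment b (Suc a) i + dot V ((?M ^^ i) b) ((A ^^ a) b)"
    by (simp add: sum.distrib dot_def del: funpow.simps)
  then show ?thesis by (simp add: self_adjoint_pow dot_commute)
qed

text \<open>
  Unrolling the two recursions writes \<open>tr M\<^sup>k\<close> as \<open>tr A\<^sup>k\<close> plus a polynomial with nonnegative
  coefficients in the numbers \<open>b\<^sup>T A\<^sup>j b\<close>, so it is monotone in them; \<open>b\<^sup>T A\<^sup>j b\<close> itself
  occurs linearly in \<open>tr M\<^bsup>j + 1\<^esup>\<close>, which gives strictness.
\<close>

lemma moment_rank_one_update_mono: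
  assumes nonneg: "\<And>j. 0 \<le> dot V b ((A ^^ j) b)"
    and le: "\<And>j. dot V b ((A ^^ j) b) \<le> dot V c ((A ^^ j) c)"
  shows "moment V (rank_one_update V A b) k \<le> moment V (rank_one_update V A c) k"
    and "dot V b ((A ^^ j) b) < dot V c ((A ^^ j) c) \<Longrightarrow>
      moment V (rank_one_update V A b) (Suc j) < moment V (rank_one_update V A c) (Suc j)"
proof -
  have mixed: "0 \<le> mixed b a i \<and> mixed b a i \<le> mixed c a i" for a i
  proof (induction i arbitrary: a)
    case 0
    then show ?case using nonneg le by simp
  next
    case (Suc i)
    have "0 \<le> mixed b a 0" "mixed b a 0 \<le> mixed c a 0" using nonneg le by simp_all
    then show ?case
      unfolding mixed_Suc using Suc.IH[of "Suc a"] Suc.IH[of 0]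
      by (intro conjI add_nonneg_nonneg mult_nonneg_nonneg add_mono mult_mono) (auto simp del: funpow.simps)
  qed
  have le_moment: "mixed_moment b a i \<le> mixed_moment c a i" for a i
  proof (induction i arbitrary: a)
    case (Suc i)
    then show ?case
      unfolding mixed_moment_Suc using mixed[of a i] Suc[of "Suc a"] by linarith
  qed simp
  then show "moment V (rank_one_update V A b) k \<le> moment V (rank_one_update V A c) k"
    using le_moment[of 0 k] by (simp add: moment_def)
  show "moment V (rank_one_update V A b) (Suc j) < moment V (rank_one_update V A c) (Suc j)"
    if strict: "dot V b ((A ^^ j) b) < dot V c ((A ^^ j) c)"
  proof -
    have "i \<le> j \<Longrightarrow> mixed_moment b (j - i) (Suc i) < mixed_moment c (j - i) (Suc i)" for i
    proof (induction i)
      case 0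
      then show ?case
        unfolding mixed_moment_Suc using le_moment[of "Suc j" 0] strict by simp
    next
      case (Suc i)
      then have "Suc (j - Suc i) = j - i" by simp
      then show ?case
        unfolding mixed_moment_Suc[where i = "Suc i"] using Suc mixed[of "j - Suc i" "Suc i"]
        by (simp del: funpow.simps)
    qed
    from this[of j] show ?thesis by (simp add: moment_def)
  qed
qed

end

section \<open>The signless Laplacian as an operator\<close>

text \<open>
  The matrix \<open>Q = D + A\<close> as an operator on functions: \<open>(D f) u + (A f) u\<close> collects one term
  \<open>f u + f v\<close> for each neighbour \<open>v\<close>. No enumeration of the vertices is involved, and the
  same function space serves all graphs on the same vertices.
\<close>

definition sl_op :: "'a rel \<Rightarrow> ('a \<Rightarrow> real) \<Rightarrow> 'a \<Rightarrow> real" where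
  "sl_op E f u = (\<Sum>v\<in>E `` {u}. f u + f v)"

locale simple_graph =
  fixes V :: "'a set" and E :: "'a rel"
  assumes finite_verts: "finite V"
    and arcs_subset: "E \<subseteq> V \<times> V"
    and sym_arcs: "(u, v) \<in> E \<Longrightarrow> (v, u) \<in> E"
    and no_loop: "(u, u) \<notin> E"
begin

lemma finite_nbrs [simp]: "finite (E `` {u})"
  using finite_verts arcs_subset by (auto intro: finite_subset[of _ V])

lemma finite_E [simp]: "finite E"
  using finite_verts arcs_subset by (auto intro: finite_subset)

lemma sym_iff: "(u, v) \<in> E \<longleftrightarrow> (v, u) \<in> E"
  using sym_arcs by blast

text \<open>
  As a sum over arcs, \<open>f\<^sup>T Q g\<close> becomes symmetric in \<open>f\<close> and \<open>g\<close> once arcs are reversed.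
\<close>

lemma self_adjoint_op_sl_op: "self_adjoint_op V (sl_op E)"
proof
  show "sl_op E (\<lambda>u. f u + c * g u) = (\<lambda>u. sl_op E f u + c * sl_op E g u)" for f g c
    by (simp add: sl_op_def fun_eq_iff sum_distrib_left sum.distrib algebra_simps)
  have as_arc_sum: "dot V f (sl_op E g) = (\<Sum>p\<in>E. f (fst p) * (g (fst p) + g (snd p)))" for f g
  proof -
    have "dot V f (sl_op E g) = (\<Sum>u\<in>V. \<Sum>v\<in>E `` {u}. f u * (g u + g v))"
      unfolding dot_def sl_op_def sum_distrib_left ..
    also have "\<dots> = (\<Sum>(u, v)\<in>(SIGMA u:V. E `` {u}). f u * (g u + g v))"
      by (rule sum.Sigma) (simp_all add: finite_verts)
    also have "(SIGMA u:V. E `` {u}) = E" using arcs_subset by auto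
    finally show ?thesis by (simp add: case_prod_beta)
  qed
  show "dot V f (sl_op E g) = dot V (sl_op E f) g" for f g
  proof -
    have swap: "(\<Sum>p\<in>E. f (fst p) * g (snd p)) = (\<Sum>p\<in>E. g (fst p) * f (snd p))"
    proof -
      have "bij_betw prod.swap E E"
        by (rule bij_betw_byWitness[where f' = prod.swap]) (auto intro: sym_arcs)
      from sum.reindex_bij_betw[OF this, of "\<lambda>p. g (fst p) * f (snd p)"] show ?thesis
        by (simp add: mult.commute)
    qed
    have "dot V f (sl_op E g) = (\<Sum>p\<in>E. f (fst p) * g (fst p)) + (\<Sum>p\<in>E. f (fst p) * g (snd p))"
      unfolding as_arc_sum distrib_left sum.distrib ..
    also have "\<dots> = (\<Sum>p\<in>E. g (fst p) * f (fst p)) + (\<Sum>p\<in>E. g (fst p) * f (snd p))"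
      unfolding swap by (simp add: mult.commute)
    also have "\<dots> = dot V g (sl_op E f)"
      unfolding as_arc_sum distrib_left sum.distrib ..
    finally show ?thesis by (simp add: dot_def mult.commute)
  qed
qed (rule finite_verts)

lemma sl_op_insert_edge:
  assumes "x \<in> V" "w \<in> V" "x \<noteq> w" "(x, w) \<notin> E"
  shows "sl_op (E \<union> {(x, w), (w, x)})
    = rank_one_update V (sl_op E) (\<lambda>u. of_bool (u = x) + of_bool (u = w))"
proof (intro ext)
  fix f u
  have dot: "dot V (\<lambda>u. of_bool (u = x) + of_bool (u = w)) f = f x + f w"
    using assms finite_verts by (simp add: dot_def distrib_right sum.distrib)
  have "(w, x) \<notin> E" using assms sym_arcs by blast
  then have "(E \<union> {(x, w), (w, x)}) `` {u}
      = (if u = x then insert w (E `` {x}) else if u = w then insert x (E `` {w}) else E `` {u})"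
    by auto
  then show "sl_op (E \<union> {(x, w), (w, x)}) f u
      = rank_one_update V (sl_op E) (\<lambda>u. of_bool (u = x) + of_bool (u = w)) f u"
    unfolding rank_one_update_def dot using assms \<open>(w, x) \<notin> E\<close>
    by (cases "u = x"; cases "u = w") (simp_all add: sl_op_def distrib_right)
qed

end

lemma pow_mat_Suc_left:
  assumes "A \<in> carrier_mat n n"
  shows "A ^\<^sub>m Suc k = A * A ^\<^sub>m k"
proof (induction k)
  case 0
  then show ?case using assms by simp
next
  case (Suc k)
  have "A * A ^\<^sub>m Suc k = A * A ^\<^sub>m k * A"
    using assms assoc_mult_mat[of A n n "A ^\<^sub>m k" n A n] by simp
  then show ?case using Suc by simp
qed

lemma signless_laplacian_pow:
  assumes "simple_graph (pverts G) (parcs G)"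
    and vs: "distinct vs" "set vs = pverts G"
    and "i < length vs" "j < length vs"
  shows "(signless_laplacian G vs ^\<^sub>m k) $$ (i, j)
    = (sl_op (parcs G) ^^ k) (\<lambda>u. of_bool (u = vs ! j)) (vs ! i)"
  using \<open>i < length vs\<close>
proof (induction k arbitrary: i)
  case 0
  then show ?case
    using assms by (auto simp: signless_laplacian_def adjacency_mat_def nth_eq_iff_index_eq)
next
  case (Suc k)
  interpret simple_graph "pverts G" "parcs G" by fact
  let ?n = "length vs" and ?Q = "signless_laplacian G vs"
  let ?f = "(sl_op (parcs G) ^^ k) (\<lambda>u. of_bool (u = vs ! j))"
  have Q: "?Q \<in> carrier_mat ?n ?n" by (auto simp: signless_laplacian_def adjacency_mat_def)
  have "out_arcs (with_proj G) u = Pair u ` (parcs G `` {u})" for u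
    by (auto simp: out_arcs_def)
  then have deg: "out_degree (with_proj G) u = card (parcs G `` {u})" for u
    by (simp add: out_degree_def card_image inj_on_def)
  have entry: "?Q $$ (i, l) = of_bool (i = l) * card (parcs G `` {vs ! i})
      + of_bool ((vs ! i, vs ! l) \<in> parcs G)" if "l < ?n" for l
    using that Suc.prems by (simp add: signless_laplacian_def adjacency_mat_def degree_mat_def
        mat_diag_def deg)
  have "(\<Sum>l<?n. of_bool ((vs ! i, vs ! l) \<in> parcs G) * ?f (vs ! l))
      = (\<Sum>v\<in>pverts G. of_bool ((vs ! i, v) \<in> parcs G) * ?f v)"
    using vs by (intro sum.reindex_bij_betw bij_betw_nth) auto
  also have "\<dots> = (\<Sum>v\<in>parcs G `` {vs ! i}. ?f v)"
    using arcs_subset finite_verts by (intro sum.mono_neutral_cong_right) auto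
  finally have adj: "(\<Sum>l<?n. of_bool ((vs ! i, vs ! l) \<in> parcs G) * ?f (vs ! l))
      = (\<Sum>v\<in>parcs G `` {vs ! i}. ?f v)" .
  have "(?Q ^\<^sub>m Suc k) $$ (i, j) = (?Q * ?Q ^\<^sub>m k) $$ (i, j)"
    by (simp only: pow_mat_Suc_left[OF Q])
  also have "\<dots> = (\<Sum>l<?n. ?Q $$ (i, l) * (?Q ^\<^sub>m k) $$ (l, j))"
    using Q Suc.prems assms(5) by (simp add: scalar_prod_def lessThan_atLeast0)
  also have "\<dots> = (\<Sum>l<?n. of_bool (i = l) * card (parcs G `` {vs ! i}) * ?f (vs ! l)
      + of_bool ((vs ! i, vs ! l) \<in> parcs G) * ?f (vs ! l))"
    by (intro sum.cong refl) (simp add: Suc.IH entry distrib_right)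
  also have "\<dots> = card (parcs G `` {vs ! i}) * ?f (vs ! i) + (\<Sum>v\<in>parcs G `` {vs ! i}. ?f v)"
    using sum.mono_neutral_right[of "{..<?n}" "{i}"
        "\<lambda>l. of_bool (i = l) * card (parcs G `` {vs ! i}) * ?f (vs ! l)"] Suc.prems
    unfolding sum.distrib adj by auto
  also have "\<dots> = sl_op (parcs G) ?f (vs ! i)"
    by (simp add: sl_op_def sum.distrib)
  finally show ?case by simp
qed

lemma SLEE_sums:
  assumes "simple_graph (pverts G) (parcs G)"
  shows "(\<lambda>k. moment (pverts G) (sl_op (parcs G)) k / fact k) sums SLEE G"
proof -
  interpret simple_graph "pverts G" "parcs G" by fact
  define vs where "vs = (SOME vs. distinct vs \<and> set vs = pverts G)"
  have "\<exists>vs. distinct vs \<and> set vs = pverts G"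
    using finite_distinct_list[OF finite_verts] by blast
  then have vs: "distinct vs" "set vs = pverts G"
    using someI_ex[of "\<lambda>vs. distinct vs \<and> set vs = pverts G"] unfolding vs_def by auto
  let ?n = "length vs" and ?Q = "signless_laplacian G vs"
  have Q: "?Q \<in> carrier_mat ?n ?n" by (auto simp: signless_laplacian_def adjacency_mat_def)
  have sym: "?Q $$ (i, j) = ?Q $$ (j, i)" if "i < ?n" "j < ?n" for i j
    using that sym_iff[of "vs ! i" "vs ! j"]
    by (simp add: signless_laplacian_def adjacency_mat_def degree_mat_def mat_diag_def)
  have "(\<Sum>i<?n. (?Q ^\<^sub>m k) $$ (i, i)) = moment (pverts G) (sl_op (parcs G)) k" for k
  proof -
    have "(\<Sum>i<?n. (?Q ^\<^sub>m k) $$ (i, i))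
        = (\<Sum>i<?n. (sl_op (parcs G) ^^ k) (\<lambda>u. of_bool (u = vs ! i)) (vs ! i))"
      using signless_laplacian_pow[OF assms vs] by simp
    also have "\<dots> = moment (pverts G) (sl_op (parcs G)) k"
      unfolding moment_def using vs by (intro sum.reindex_bij_betw bij_betw_nth) auto
    finally show ?thesis .
  qed
  then show ?thesis
    using symmetric_mat_exp_sums[OF Q sym] unfolding SLEE_def signless_spectrum_def vs_def by simp
qed

lemma sums_less:
  fixes f g :: "nat \<Rightarrow> real"
  assumes "f sums a" "g sums b" "\<And>k. f k \<le> g k" "f i < g i"
  shows "a < b"
proof -
  have d: "(\<lambda>k. g k - f k) sums (b - a)" using assms sums_diff by blast
  then have "0 < (\<Sum>k. g k - f k)"
    using assms by (intro suminf_pos2[of _ i]) (auto simp: sums_iff)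
  with d show ?thesis by (simp add: sums_iff)
qed


section \<open>Sliding an edge along a pendant path\<close>

text \<open>
  A path that hangs at \<open>p 0\<close>, whose neighbourhood is not restricted, and ends in the leaf \<open>p m\<close>.
\<close>

locale pendant_path = simple_graph V E for V :: "'a set" and E :: "'a rel" +
  fixes p :: "nat \<Rightarrow> 'a" and m :: nat
  assumes path_inj: "inj_on p {..m}"
    and path_interior: "0 < j \<Longrightarrow> j < m \<Longrightarrow> E `` {p j} = {p (j - 1), p (Suc j)}"
    and path_end: "E `` {p m} = {p (m - 1)}"
    and path_length: "0 < m"
begin

lemma path_eq_iff: "j \<le> m \<Longrightarrow> k \<le> m \<Longrightarrow> p j = p k \<longleftrightarrow> j = k"
  using path_inj by (auto simp: inj_on_def)

lemma path_arc:
  assumes "j < m"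
  shows "(p j, p (Suc j)) \<in> E"
proof -
  have "p j \<in> E `` {p (Suc j)}"
  proof (cases "Suc j = m")
    case True
    then show ?thesis using path_end by fastforce
  next
    case False
    then show ?thesis using path_interior[of "Suc j"] assms by simp
  qed
  then show ?thesis by (simp add: sym_arcs)
qed

lemma path_in_V:
  assumes "j \<le> m"
  shows "p j \<in> V"
proof (cases "j < m")
  case True
  then show ?thesis using path_arc arcs_subset by blast
next
  case False
  then show ?thesis using path_arc[of "m - 1"] path_length arcs_subset assms by auto
qed

lemma sl_op_interior:
  assumes "0 < j" "j < m"
  shows "sl_op E f (p j) = 2 * f (p j) + f (p (j - 1)) + f (p (Suc j))"
proof -
  have "p (j - 1) \<noteq> p (Suc j)" using assms by (subst path_eq_iff) auto
  then show ?thesis using assms by (simp add: sl_op_def path_interior)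
qed

lemma sl_op_end: "sl_op E f (p m) = f (p m) + f (p (m - 1))"
  by (simp add: sl_op_def path_end)

lemma sl_op_start:
  assumes nonneg: "\<And>v. 0 \<le> f v"
  shows "f (p 0) + f (p 1) \<le> sl_op E f (p 0)"
    and "2 \<le> card (E `` {p 0}) \<Longrightarrow> 2 * f (p 0) + f (p 1) \<le> sl_op E f (p 0)"
proof -
  have "p 1 \<in> E `` {p 0}" using path_arc[of 0] path_length by simp
  then have split: "sl_op E f (p 0) = f (p 0) + f (p 1) + (\<Sum>v\<in>E `` {p 0} - {p 1}. f (p 0) + f v)"
    unfolding sl_op_def by (intro sum.remove) simp_all
  show "f (p 0) + f (p 1) \<le> sl_op E f (p 0)"
    unfolding split using nonneg by (simp add: sum_nonneg)
  assume "2 \<le> card (E `` {p 0})"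
  then have "card (E `` {p 0} - {p 1}) \<noteq> 0"
    using \<open>p 1 \<in> E `` {p 0}\<close> by (simp add: card_Diff_singleton)
  then obtain v where "v \<in> E `` {p 0} - {p 1}" by (metis card.empty equals0I)
  then have "f (p 0) + f v \<le> (\<Sum>v\<in>E `` {p 0} - {p 1}. f (p 0) + f v)"
    using nonneg by (intro member_le_sum) auto
  then show "2 * f (p 0) + f (p 1) \<le> sl_op E f (p 0)"
    unfolding split using nonneg[of v] by simp
qed

text \<open>
  The reversal \<open>p j \<mapsto> p (m - j)\<close> of the path compares each vertex of the near half with one of the far
  half. The functions called tilted form the invariant cone on which the slide rests.
\<close>

definition gap :: "('a \<Rightarrow> real) \<Rightarrow> nat \<Rightarrow> real" where
  "gap f j = f (p j) - f (p (m - j))"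

definition tilted :: "('a \<Rightarrow> real) \<Rightarrow> bool" where
  "tilted f \<longleftrightarrow> (\<forall>v. 0 \<le> f v) \<and> (\<forall>j. 2 * j < m \<longrightarrow> 0 \<le> gap f j)"

lemma tiltedD: "tilted f \<Longrightarrow> 0 \<le> f v" "tilted f \<Longrightarrow> 2 * j < m \<Longrightarrow> 0 \<le> gap f j"
  by (auto simp: tilted_def)

text \<open>
  If \<open>2 * j + 1 = m\<close>, then \<open>Suc j\<close> and \<open>j\<close> are mirror images and the second summand cancels the
  first; otherwise \<open>Suc j\<close> is still in the near half, or is its own mirror image.
\<close>

lemma gap_next:
  assumes "tilted f" "2 * j < m"
  shows "0 \<le> gap f j + (f (p (Suc j)) - f (p (m - Suc j)))"
proof (cases "2 * j + 1 = m")
  case True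
  then have "m - j = Suc j" "m - Suc j = j" by auto
  then show ?thesis by (simp add: gap_def)
next
  case False
  have "0 \<le> gap f j" using assms tiltedD by blast
  moreover have "0 \<le> gap f (Suc j)"
  proof (cases "2 * Suc j = m")
    case True
    then have "m - Suc j = Suc j" by simp
    then show ?thesis by (simp add: gap_def)
  qed (use assms False tiltedD in auto)
  ultimately show ?thesis by (simp add: gap_def)
qed

lemma gap_sl_op_interior:
  assumes "tilted f" "0 < j" "2 * j < m"
  shows "gap f (j - 1) \<le> gap (sl_op E f) j"
proof -
  have "m - j - 1 = m - Suc j" "Suc (m - j) = m - (j - 1)" using assms by auto
  then have "gap (sl_op E f) j
      = 2 * gap f j + gap f (j - 1) + (f (p (Suc j)) - f (p (m - Suc j)))"
    using assms by (simp add: gap_def sl_op_interior)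
  then show ?thesis
    using gap_next[OF assms(1,3)] tiltedD(2)[OF assms(1,3)] by linarith
qed

text \<open>
  At the far end \<open>Q f\<close> sees only \<open>p (m - 1)\<close>, at the near end it sees \<open>p 1\<close> and possibly more. A
  further neighbour of \<open>p 0\<close> contributes at least \<open>f (p 0)\<close>, which is the source of strict
  inequality.
\<close>

lemma gap_sl_op_start:
  assumes "tilted f"
  shows "0 \<le> gap (sl_op E f) 0"
    and "2 \<le> card (E `` {p 0}) \<Longrightarrow> f (p 0) \<le> gap (sl_op E f) 0"
proof -
  have "gap (sl_op E f) 0 = sl_op E f (p 0) - f (p m) - f (p (m - 1))"
    by (simp add: gap_def sl_op_end)
  moreover have "f (p m) + f (p (m - 1)) \<le> f (p 0) + f (p 1)"
    using gap_next[OF assms, of 0] path_length by (simp add: gap_def)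
  ultimately have *: "sl_op E f (p 0) - f (p 0) - f (p 1) \<le> gap (sl_op E f) 0" by simp
  have nonneg: "0 \<le> f v" for v using assms by (rule tiltedD)
  show "0 \<le> gap (sl_op E f) 0" using sl_op_start(1)[of f, OF nonneg] * by linarith
  show "f (p 0) \<le> gap (sl_op E f) 0" if "2 \<le> card (E `` {p 0})"
    using sl_op_start(2)[of f, OF nonneg that] * by linarith
qed

lemma sl_op_nonneg: "(\<And>v. 0 \<le> f v) \<Longrightarrow> 0 \<le> sl_op E f u"
  by (simp add: sl_op_def sum_nonneg)

lemma tilted_sl_op: 
  assumes "tilted f"
  shows "tilted (sl_op E f)"
  unfolding tilted_def
proof (intro conjI allI impI)
  show "0 \<le> sl_op E f v" for v using assms by (intro sl_op_nonneg tiltedD)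
  show "0 \<le> gap (sl_op E f) j" if "2 * j < m" for j
  proof (cases "j = 0")
    case False
    then have "0 \<le> gap f (j - 1)" using that assms by (intro tiltedD) auto
    then show ?thesis using gap_sl_op_interior[OF assms, of j] False that by simp
  qed (simp add: gap_sl_op_start[OF assms])
qed

lemma tilted_sl_op_pow: "tilted f \<Longrightarrow> tilted ((sl_op E ^^ k) f)"
  by (induction k) (simp_all add: tilted_sl_op)

text \<open>
  Positive mass at \<open>p i\<close> reaches \<open>p 0\<close> after \<open>i\<close> steps, one more step makes the gap at 0 positive,
  and the gap travels back to \<open>i\<close> in another \<open>i\<close> steps.
\<close>

lemma gap_eventually_pos:
  assumes "tilted f" "0 < f (p i)" "2 * i < m" "2 \<le> card (E `` {p 0})"
  shows "0 < gap ((sl_op E ^^ (2 * i + 1)) f) i"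
proof -
  let ?f = "\<lambda>k. (sl_op E ^^ k) f"
  note tilted = tilted_sl_op_pow[OF assms(1)]
  have "k \<le> i \<Longrightarrow> 0 < ?f k (p (i - k))" for k
  proof (induction k)
    case (Suc k)
    then have pos: "0 < ?f k (p (i - k))" and idx: "Suc (i - Suc k) = i - k" by simp_all
    have "?f k (p (i - k)) \<le> sl_op E (?f k) (p (i - Suc k))"
    proof (cases "i - Suc k = 0")
      case True
      then have "i - k = 1" using idx by simp
      moreover have "0 \<le> ?f k (p 0)" using tilted by (rule tiltedD)
      ultimately show ?thesis
        using sl_op_start(1)[of "?f k", OF tiltedD(1)[OF tilted]] True by simp
    next
      case False
      have "2 * ?f k (p (i - Suc k)) + ?f k (p (i - Suc k - 1)) + ?f k (p (i - k))
          = sl_op E (?f k) (p (i - Suc k))"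
        using sl_op_interior[of "i - Suc k" "?f k"] False idx assms(3) by simp
      then show ?thesis
        using tiltedD(1)[OF tilted, of k "p (i - Suc k)"]
          tiltedD(1)[OF tilted, of k "p (i - Suc k - 1)"] by linarith
    qed
    then show ?case using pos by simp
  qed (use assms in simp)
  from this[of i] have pos: "0 < ?f i (p 0)" by simp
  have "k \<le> i \<Longrightarrow> 0 < gap (?f (i + 1 + k)) k" for k
  proof (induction k)
    case 0
    then show ?case using gap_sl_op_start(2)[OF tilted assms(4), of i] pos by simp
  next
    case (Suc k)
    have "gap (?f (i + 1 + k)) (Suc k - 1) \<le> gap (sl_op E (?f (i + 1 + k))) (Suc k)"
      using Suc.prems assms(3) by (intro gap_sl_op_interior tilted) auto
    then show ?case using Suc by simp
  qed
  from this[of i] show ?thesis by (simp add: mult_2)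
qed

text \<open>
  With \<open>b\<^sub>x = e\<^sub>x + e\<^sub>w\<close> and \<open>b\<^sub>z = e\<^sub>z + e\<^sub>w\<close> for \<open>x = p i\<close> and \<open>z = p (m - i)\<close>, self-adjointness gives
  \<open>b\<^sub>x\<^sup>T Q\<^sup>j b\<^sub>x - b\<^sub>z\<^sup>T Q\<^sup>j b\<^sub>z = (b\<^sub>x - b\<^sub>z)\<^sup>T Q\<^sup>j (b\<^sub>x + b\<^sub>z)\<close>. Here \<open>b\<^sub>x - b\<^sub>z = e\<^sub>x - e\<^sub>z\<close>
  reads off a gap and \<open>c = b\<^sub>x + b\<^sub>z\<close> is tilted, so the difference is nonnegative.
\<close>

lemma moments_decrease:
  assumes i: "2 * i < m" and w: "w \<in> V" "w \<notin> p ` {..m}"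
    and nonadj: "(p i, w) \<notin> E" "(p (m - i), w) \<notin> E"
    and deg: "2 \<le> card (E `` {p 0})"
  defines "E\<^sub>1 \<equiv> E \<union> {(p i, w), (w, p i)}" and "E\<^sub>2 \<equiv> E \<union> {(p (m - i), w), (w, p (m - i))}"
  shows "moment V (sl_op E\<^sub>2) k \<le> moment V (sl_op E\<^sub>1) k"
    and "\<exists>k. moment V (sl_op E\<^sub>2) k < moment V (sl_op E\<^sub>1) k"
proof -
  interpret A: self_adjoint_op V "sl_op E" by (rule self_adjoint_op_sl_op)
  define b :: "'a \<Rightarrow> 'a \<Rightarrow> real" where "b x = (\<lambda>u. of_bool (u = x) + of_bool (u = w))" for x
  let ?x = "p i" and ?z = "p (m - i)"
  define c where "c = (\<lambda>u. b ?x u + 1 * b ?z u)"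
  have inV: "?x \<in> V" "?z \<in> V" using i by (auto intro: path_in_V)
  have ne: "?x \<noteq> w" "?z \<noteq> w" using i w by auto
  have upd: "sl_op E\<^sub>1 = rank_one_update V (sl_op E) (b ?x)"
    "sl_op E\<^sub>2 = rank_one_update V (sl_op E) (b ?z)"
    unfolding E\<^sub>1_def E\<^sub>2_def b_def using inV ne w nonadj by (intro sl_op_insert_edge; simp)+
  have dot_b: "dot V (b x) g = g x + g w" if "x \<in> V" for x g
    using that w finite_verts by (simp add: dot_def b_def distrib_right sum.distrib)
  have "tilted c"
  proof -
    have "gap c j = 0" if "2 * j < m" for j
    proof -
      have "p j \<noteq> w" "p (m - j) \<noteq> w" using w that by auto
      moreover have "p j = ?x \<longleftrightarrow> j = i" "p (m - j) = ?z \<longleftrightarrow> j = i" "p j \<noteq> ?z" "p (m - j) \<noteq> ?x"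
        using that i by (subst path_eq_iff; simp; linarith)+
      ultimately show ?thesis by (simp add: gap_def c_def b_def)
    qed
    then show ?thesis by (auto simp: tilted_def c_def b_def)
  qed
  have diff: "dot V (b ?x) ((sl_op E ^^ j) (b ?x)) - dot V (b ?z) ((sl_op E ^^ j) (b ?z))
      = gap ((sl_op E ^^ j) c) i" for j
  proof -
    let ?Q = "sl_op E ^^ j"
    have cross: "dot V (b ?x) (?Q (b ?z)) = dot V (b ?z) (?Q (b ?x))"
      using A.self_adjoint_pow A.dot_commute by metis
    have "gap (?Q c) i = dot V (b ?x) (?Q c) - dot V (b ?z) (?Q c)"
      using inV by (simp add: dot_b gap_def)
    also have "\<dots> = dot V (b ?x) (?Q (b ?x)) + dot V (b ?x) (?Q (b ?z))
        - (dot V (b ?z) (?Q (b ?x)) + dot V (b ?z) (?Q (b ?z)))"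
      unfolding c_def A.linear_pow A.dot_add_right by simp
    finally show ?thesis using cross by simp
  qed
  have nonneg: "0 \<le> dot V (b ?z) ((sl_op E ^^ j) (b ?z))" for j
  proof -
    have "0 \<le> (sl_op E ^^ j) (b ?z) v" for v
      by (induction j arbitrary: v) (auto simp: b_def intro: sl_op_nonneg)
    then show ?thesis using inV by (simp add: dot_b)
  qed
  have le: "dot V (b ?z) ((sl_op E ^^ j) (b ?z)) \<le> dot V (b ?x) ((sl_op E ^^ j) (b ?x))" for j
    using diff[of j] tiltedD(2)[OF tilted_sl_op_pow[OF \<open>tilted c\<close>] i, of j] by simp
  show "moment V (sl_op E\<^sub>2) k \<le> moment V (sl_op E\<^sub>1) k"
    unfolding upd by (rule A.moment_rank_one_update_mono(1)[OF nonneg le])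
  have "0 < c ?x" by (simp add: c_def b_def)
  then have "0 < gap ((sl_op E ^^ (2 * i + 1)) c) i"
    using \<open>tilted c\<close> i deg by (intro gap_eventually_pos)
  then have "dot V (b ?z) ((sl_op E ^^ (2 * i + 1)) (b ?z))
      < dot V (b ?x) ((sl_op E ^^ (2 * i + 1)) (b ?x))"
    using diff[of "2 * i + 1"] by simp
  from A.moment_rank_one_update_mono(2)[OF nonneg le this]
  show "\<exists>k. moment V (sl_op E\<^sub>2) k < moment V (sl_op E\<^sub>1) k"
    unfolding upd by blast
qed

end

lemma (in simple_graph) simple_graph_insert_edge:
  assumes "x \<in> V" "w \<in> V" "x \<noteq> w"
  shows "simple_graph V (E \<union> {(x, w), (w, x)})"
proof
  show "(v, u) \<in> E \<union> {(x, w), (w, x)}" if "(u, v) \<in> E \<union> {(x, w), (w, x)}" for u v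
    using that sym_iff[of u v] by auto
qed (use assms finite_verts arcs_subset no_loop in auto)

lemma (in pendant_path) SLEE_slide:
  assumes "2 * i < m" "w \<in> V" "w \<notin> p ` {..m}"
    and "(p i, w) \<notin> E" "(p (m - i), w) \<notin> E" "2 \<le> card (E `` {p 0})"
  shows "SLEE \<lparr>pverts = V, parcs = E \<union> {(p (m - i), w), (w, p (m - i))}\<rparr>
    < SLEE \<lparr>pverts = V, parcs = E \<union> {(p i, w), (w, p i)}\<rparr>"
proof -
  have ne: "p j \<noteq> w" if "j \<le> m" for j using that assms(3) by blast
  have g: "simple_graph V (E \<union> {(p j, w), (w, p j)})" if "j \<le> m" for j
    by (rule simple_graph_insert_edge[OF path_in_V[OF that] assms(2) ne[OF that]])
  have "i \<le> m" using assms(1) by simp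
  obtain k where k: "moment V (sl_op (E \<union> {(p (m - i), w), (w, p (m - i))})) k
      < moment V (sl_op (E \<union> {(p i, w), (w, p i)})) k"
    using moments_decrease(2)[OF assms] by blast
  show ?thesis
  proof (rule sums_less[OF SLEE_sums SLEE_sums])
    show "simple_graph (pverts \<lparr>pverts = V, parcs = E \<union> {(p (m - i), w), (w, p (m - i))}\<rparr>)
        (parcs \<lparr>pverts = V, parcs = E \<union> {(p (m - i), w), (w, p (m - i))}\<rparr>)"
      using g[of "m - i"] by simp
    show "simple_graph (pverts \<lparr>pverts = V, parcs = E \<union> {(p i, w), (w, p i)}\<rparr>)
        (parcs \<lparr>pverts = V, parcs = E \<union> {(p i, w), (w, p i)}\<rparr>)"
      using g[OF \<open>i \<le> m\<close>] by simp
    show "moment (pverts \<lparr>pverts = V, parcs = E \<union> {(p (m - i), w), (w, p (m - i))}\<rparr>)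
          (sl_op (parcs \<lparr>pverts = V, parcs = E \<union> {(p (m - i), w), (w, p (m - i))}\<rparr>)) l / fact l
        \<le> moment (pverts \<lparr>pverts = V, parcs = E \<union> {(p i, w), (w, p i)}\<rparr>)
          (sl_op (parcs \<lparr>pverts = V, parcs = E \<union> {(p i, w), (w, p i)}\<rparr>)) l / fact l" for l
      using moments_decrease(1)[OF assms, of l]
      by (simp only: pair_pre_digraph.simps) (rule divide_right_mono, simp_all)
    show "moment (pverts \<lparr>pverts = V, parcs = E \<union> {(p (m - i), w), (w, p (m - i))}\<rparr>)
          (sl_op (parcs \<lparr>pverts = V, parcs = E \<union> {(p (m - i), w), (w, p (m - i))}\<rparr>)) k / fact k
        < moment (pverts \<lparr>pverts = V, parcs = E \<union> {(p i, w), (w, p i)}\<rparr>)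
          (sl_op (parcs \<lparr>pverts = V, parcs = E \<union> {(p i, w), (w, p i)}\<rparr>)) k / fact k"
      using k by (simp only: pair_pre_digraph.simps) (rule divide_strict_right_mono, simp_all)
  qed
qed


section \<open>Unicyclic graphs\<close>

text \<open>
  Every undirected edge is counted by two arcs in \<open>card_arcs\<close>.
\<close>

locale unicyclic_graph = simple_graph V E for V :: "'a set" and E :: "'a rel" +
  assumes nonempty: "V \<noteq> {}"
    and conn: "u \<in> V \<Longrightarrow> v \<in> V \<Longrightarrow> (u, v) \<in> E\<^sup>*"
    and card_arcs: "card E = 2 * card V"

definition has_leaf :: "'a rel \<Rightarrow> bool" where
  "has_leaf E \<longleftrightarrow> (\<exists>z. card (E `` {z}) = 1)"

context simple_graph
begin

lemma nbr_in_V: "v \<in> E `` {u} \<Longrightarrow> u \<in> V \<and> v \<in> V"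
  using arcs_subset by auto

lemma sum_degrees: "(\<Sum>v\<in>V. card (E `` {v})) = card E"
proof -
  have "card (SIGMA v:V. E `` {v}) = (\<Sum>v\<in>V. card (E `` {v}))"
    using finite_verts by (intro card_SigmaI) auto
  moreover have "(SIGMA v:V. E `` {v}) = E" using arcs_subset by auto
  ultimately show ?thesis by simp
qed

lemma inj_in_V_bound:
  assumes "inj_on r {..k}" "\<And>j. j \<le> k \<Longrightarrow> r j \<in> V"
  shows "k < card V"
  using card_inj_on_le[OF assms(1) _ finite_verts] assms(2) by (simp add: image_subset_iff Suc_le_eq)

end

context unicyclic_graph
begin

lemma closed_eq_V:
  assumes "S \<subseteq> V" "u \<in> S" "\<And>v. v \<in> S \<Longrightarrow> E `` {v} \<subseteq> S"
  shows "S = V"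
proof -
  have "v \<in> S" if "(u, v) \<in> E\<^sup>*" for v
    using that assms(2) by induction (use assms(3) in auto)
  then show ?thesis using assms(1,2) conn by blast
qed

lemma degree_pos:
  assumes "2 \<le> card V" "v \<in> V"
  shows "1 \<le> card (E `` {v})"
proof (rule ccontr)
  assume "\<not> 1 \<le> card (E `` {v})"
  then have "E `` {v} = {}" by (simp add: not_le)
  then have "{v} = V" using assms(2) by (intro closed_eq_V[of _ v]) auto
  then show False using assms(1) by auto
qed

lemma leaf_in_V: "card (E `` {z}) = 1 \<Longrightarrow> z \<in> V"
  by (metis One_nat_def card_1_singletonE insertI1 nbr_in_V)

lemma leaf_card_V: 
  assumes "card (E `` {z}) = 1"
  shows "2 \<le> card V"
proof -
  obtain x where x: "E `` {z} = {x}" using assms by (auto simp: card_1_singleton_iff)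
  then have "z \<noteq> x" "{z, x} \<subseteq> V" using no_loop nbr_in_V[of x z] by auto
  then show ?thesis using card_mono[OF finite_verts, of "{z, x}"] by simp
qed

lemma all_degrees_2:
  assumes "\<And>v. v \<in> V \<Longrightarrow> 2 \<le> card (E `` {v})" "v \<in> V"
  shows "card (E `` {v}) = 2"
proof (rule ccontr)
  assume "card (E `` {v}) \<noteq> 2"
  then have "2 < card (E `` {v})" using assms by force
  then have "(\<Sum>v\<in>V. 2) < (\<Sum>v\<in>V. card (E `` {v}))"
    using assms finite_verts by (intro sum_strict_mono_ex1) auto
  then show False using sum_degrees card_arcs by simp
qed

end

subsection \<open>Pendant paths\<close>

text \<open>
  The last vertex \<open>r k\<close> is exempt from the degree condition, so that a longest such path exhibits
  the vertex at which the pendant path from \<open>z\<close> is attached.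
\<close>

definition (in simple_graph) trace_from :: "'a \<Rightarrow> nat \<Rightarrow> (nat \<Rightarrow> 'a) \<Rightarrow> bool" where
  "trace_from z k r \<longleftrightarrow> r 0 = z \<and> inj_on r {..k} \<and> (\<forall>j<k. (r j, r (Suc j)) \<in> E)
     \<and> (\<forall>j. 0 < j \<and> j < k \<longrightarrow> card (E `` {r j}) = 2)"

lemma (in simple_graph) trace_interior:
  assumes "trace_from z k r" "0 < j" "j < k"
  shows "E `` {r j} = {r (j - 1), r (Suc j)}"
proof -
  have "(r (j - 1), r j) \<in> E" "(r j, r (Suc j)) \<in> E" "card (E `` {r j}) = 2"
    using assms spec[of "\<lambda>j. j < k \<longrightarrow> (r j, r (Suc j)) \<in> E" "j - 1"]
    by (auto simp: trace_from_def)
  moreover have "r (j - 1) \<noteq> r (Suc j)"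
    using assms by (auto simp: trace_from_def inj_on_eq_iff[of r "{..k}"])
  ultimately show ?thesis
    by (intro card_seteq[symmetric]) (auto intro: sym_arcs)
qed

text \<open>
  A longest path from the leaf through vertices of degree 2 cannot end in a vertex of degree 2,
  since it could be extended, nor in a leaf: then it would be the whole graph, whose degree sum is too
  small for as many edges as vertices. Reversed, it is the required path.
\<close>

lemma (in unicyclic_graph) leaf_pendant_path:
  assumes leaf: "card (E `` {z}) = 1"
  obtains p m where "pendant_path V E p m" "p m = z" "3 \<le> card (E `` {p 0})"
proof -
  have bound: "k < card V" if "trace_from z k r" for k r
  proof (rule inj_in_V_bound)
    show "inj_on r {..k}" using that by (simp add: trace_from_def)
    fix j assume "j \<le> k"
    show "r j \<in> V"
    proof (cases j)
      case 0
      then show ?thesis using that leaf_in_V[OF leaf] by (simp add: trace_from_def)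
    next
      case (Suc i)
      then have "(r i, r j) \<in> E" using that \<open>j \<le> k\<close> by (simp add: trace_from_def)
      then show ?thesis using arcs_subset by auto
    qed
  qed
  obtain y where y: "E `` {z} = {y}" using leaf by (auto simp: card_1_singleton_iff)
  have "trace_from z 1 (\<lambda>j. if j = 0 then z else y)"
    using y no_loop by (auto simp: trace_from_def inj_on_def le_Suc_eq)
  then have ex1: "\<exists>r. trace_from z 1 r" by blast
  define k where "k = (GREATEST k. \<exists>r. trace_from z k r)"
  have "\<exists>r. trace_from z k r"
    unfolding k_def
    by (rule GreatestI_nat[where P = "\<lambda>k. \<exists>r. trace_from z k r" and b = "card V", OF ex1]) (use bound in \<open>auto intro: less_imp_le\<close>)
  moreover have max: "l \<le> k" if "trace_from z l r" for l r
    unfolding k_def by (rule Greatest_le_nat[where P = "\<lambda>k. \<exists>r. trace_from z k r" and b = "card V"]) (use that bound in \<open>auto intro: less_imp_le\<close>)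
  ultimately obtain r where r: "trace_from z k r" by blast
  have k: "1 \<le> k" using max ex1 by blast
  have inj: "r i = r j \<longleftrightarrow> i = j" if "i \<le> k" "j \<le> k" for i j
    using r that by (auto simp: trace_from_def inj_on_def)
  have r0: "r 0 = z" using r by (simp add: trace_from_def)
  have arc: "(r j, r (Suc j)) \<in> E" if "j < k" for j
    using r that by (simp add: trace_from_def)
  have end0: "E `` {r 0} = {r 1}" using y arc[of 0] r0 k by auto
  have prev: "r (k - 1) \<in> E `` {r k}" using sym_arcs[OF arc[of "k - 1"]] k by simp
  note interior = trace_interior[OF r]
  have rV: "r ` {..k} \<subseteq> V"
  proof
    fix v assume "v \<in> r ` {..k}"
    then obtain j where "j \<le> k" "v = r j" by auto
    then show "v \<in> V" using arc[of j] arc[of "k - 1"] k arcs_subset by (cases "j = k") auto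
  qed
  have only_prev: "u = r (k - 1)" if u: "u \<in> E `` {r k}" "u \<in> r ` {..k}" for u
  proof -
    obtain j where j: "j \<le> k" "u = r j" using u(2) by auto
    have "r k \<in> E `` {r j}" using u(1) j(2) sym_iff[of "r j" "r k"] by simp
    moreover have "j \<noteq> k" using u(1) j(2) no_loop by auto
    ultimately have "k = Suc j"
      using j(1) end0 interior[of j] inj[of k "j - 1"] inj[of k "Suc j"] inj[of k 1] k
      by (cases "j = 0") auto
    then show ?thesis using j by simp
  qed
  have "3 \<le> card (E `` {r k})"
  proof (rule ccontr)
    assume "\<not> 3 \<le> card (E `` {r k})"
    moreover have "card (E `` {r k}) \<noteq> 0" using prev by auto
    ultimately consider "card (E `` {r k}) = 1" | "card (E `` {r k}) = 2" by linarith
    then show False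
    proof cases
      case 1
      then have endk: "E `` {r k} = {r (k - 1)}"
        using prev by (metis card_1_singletonE singletonD)
      have "E `` {v} \<subseteq> r ` {..k} \<and> card (E `` {v}) \<le> 2" if v: "v \<in> r ` {..k}" for v
      proof -
        obtain j where j: "j \<le> k" "v = r j" using v by auto
        consider "j = 0" | "0 < j" "j < k" | "j = k" using j by linarith
        then show ?thesis
        proof cases
          case 1
          then show ?thesis using end0 k j by auto
        next
          case 2
          then show ?thesis using interior[of j] j by (auto simp: card_insert_if)
        next
          case 3
          then show ?thesis using endk j by auto
        qed
      qed
      moreover from this have "r ` {..k} = V"
        using rV by (intro closed_eq_V[of _ "r 0"]) auto
      ultimately have "\<And>v. v \<in> V \<Longrightarrow> card (E `` {v}) \<le> 2" by blast
      then have "(\<Sum>v\<in>V. card (E `` {v})) < (\<Sum>v\<in>V. 2)"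
        using leaf leaf_in_V[OF leaf] finite_verts by (intro sum_strict_mono_ex1) force+
      then show False using sum_degrees card_arcs by simp
    next
      case 2
      then obtain u where u: "u \<in> E `` {r k}" "u \<noteq> r (k - 1)"
        using prev by (auto simp: card_2_iff)
      then have new: "u \<notin> r ` {..k}" using only_prev by blast
      have "trace_from z (Suc k) (r(Suc k := u))"
        unfolding trace_from_def
      proof (intro conjI allI impI)
        show "(r(Suc k := u)) 0 = z" using r0 k by simp
        show "inj_on (r(Suc k := u)) {..Suc k}"
          using new inj by (auto simp: inj_on_def le_Suc_eq)
        show "((r(Suc k := u)) j, (r(Suc k := u)) (Suc j)) \<in> E" if "j < Suc k" for j
          using that arc[of j] u by (cases "j = k") auto
        show "card (E `` {(r(Suc k := u)) j}) = 2" if "0 < j \<and> j < Suc k" for j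
          using that 2 r by (cases "j = k") (auto simp: trace_from_def)
      qed
      then show False using max by fastforce
    qed
  qed
  moreover have "pendant_path V E (\<lambda>j. r (k - j)) k"
  proof
    show "inj_on (\<lambda>j. r (k - j)) {..k}" using inj by (auto simp: inj_on_def)
    show "E `` {r (k - j)} = {r (k - (j - 1)), r (k - Suc j)}" if "0 < j" "j < k" for j
    proof -
      have "k - j - 1 = k - Suc j" "Suc (k - j) = k - (j - 1)" using that by auto
      then show ?thesis using interior[of "k - j"] that by auto
    qed
    show "E `` {r (k - k)} = {r (k - (k - 1))}" using end0 k by simp
  qed (use k in simp)
  ultimately show thesis using that[of "\<lambda>j. r (k - j)" k] r0 k by simp
qed

lemma (in pendant_path) nbr_of_start_off_path:
  assumes "w \<in> E `` {p 0}" "w \<noteq> p 1"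
  shows "w \<notin> p ` {..m}"
proof
  assume "w \<in> p ` {..m}"
  then obtain j where j: "j \<le> m" "w = p j" by auto
  have "p 0 \<in> E `` {p j}" using assms(1) j(2) sym_iff[of "p j" "p 0"] by simp
  moreover have "j \<noteq> 0" using assms(1) j(2) no_loop by (metis ImageE singletonD)
  moreover have "p 0 \<noteq> p (Suc j)" if "j < m" using that by (simp add: path_eq_iff)
  ultimately have "p 0 = p (j - 1)"
    using path_interior[of j] path_end j(1) by (cases "j = m") auto
  moreover have "j - 1 \<le> m" using j(1) by simp
  ultimately have "0 = j - 1" by (simp only: path_eq_iff)
  then have "j = 1" using \<open>j \<noteq> 0\<close> by simp
  then show False using assms(2) j by simp
qed


section \<open>Edge moves that decrease the index\<close>

definition move_arc :: "'a rel \<Rightarrow> 'a \<Rightarrow> 'a \<Rightarrow> 'a \<Rightarrow> 'a rel" where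
  "move_arc E w x z = E - {(x, w), (w, x)} \<union> {(z, w), (w, z)}"

lemma (in simple_graph) simple_graph_remove_edge:
  "simple_graph V (E - {(x, w), (w, x)})"
proof
  show "(v, u) \<in> E - {(x, w), (w, x)}" if "(u, v) \<in> E - {(x, w), (w, x)}" for u v
    using that sym_iff[of u v] by auto
qed (use finite_verts arcs_subset no_loop in auto)

lemma (in simple_graph) card_nbrs_move_arc:
  assumes "(x, w) \<in> E" "(z, w) \<notin> E" "v \<noteq> x" "v \<noteq> z" "w \<noteq> x" "w \<noteq> z"
  shows "card (move_arc E w x z `` {v}) = card (E `` {v})"
proof (cases "v = w")
  case True
  then have eq: "move_arc E w x z `` {v} = insert z (E `` {v} - {x})"
    using assms by (auto simp: move_arc_def)
  have "x \<in> E `` {v}" "z \<notin> E `` {v} - {x}"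
    using assms True sym_iff[of w x] sym_iff[of w z] by auto
  then show ?thesis
    unfolding eq using card_insert_disjoint[of "E `` {v} - {x}" z]
      card_Suc_Diff1[OF finite_nbrs, of x v] by (metis finite_Diff finite_nbrs)
next
  case False
  then have "move_arc E w x z `` {v} = E `` {v}"
    using assms by (auto simp: move_arc_def)
  then show ?thesis by simp
qed

text \<open>
  The number of arcs is unchanged, and a detour along the path replaces the old edge from \<open>p i\<close> to
  \<open>w\<close>, so the graph stays connected.
\<close>

lemma (in unicyclic_graph) slide:
  assumes path: "pendant_path V (E - {(p i, w), (w, p i)}) p m"
    and i: "2 * i < m" and arc: "(p i, w) \<in> E" and w: "w \<notin> p ` {..m}"
    and nonadj: "(p (m - i), w) \<notin> E"
    and deg: "2 \<le> card ((E - {(p i, w), (w, p i)}) `` {p 0})"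
  shows "unicyclic_graph V (move_arc E w (p i) (p (m - i)))"
    and "SLEE \<lparr>pverts = V, parcs = move_arc E w (p i) (p (m - i))\<rparr> < SLEE \<lparr>pverts = V, parcs = E\<rparr>"
proof -
  let ?K = "E - {(p i, w), (w, p i)}" and ?x = "p i" and ?z = "p (m - i)"
  interpret K: pendant_path V ?K p m by (rule path)
  let ?E' = "move_arc E w ?x ?z"
  have wV: "w \<in> V" using arc arcs_subset by auto
  have ne: "?x \<noteq> w" "?z \<noteq> w" using w i by auto
  have E: "E = ?K \<union> {(?x, w), (w, ?x)}" using arc sym_arcs[OF arc] by auto
  have zV: "?z \<in> V" by (rule K.path_in_V) simp
  show "SLEE \<lparr>pverts = V, parcs = ?E'\<rparr> < SLEE \<lparr>pverts = V, parcs = E\<rparr>"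
    unfolding move_arc_def
    using K.SLEE_slide[OF i wV w _ _ deg] nonadj E by auto
  interpret E': simple_graph V ?E'
    unfolding move_arc_def by (rule K.simple_graph_insert_edge[OF zV wV ne(2)])
  have walk: "(p j, p (j + l)) \<in> ?E'\<^sup>*" if "j + l \<le> m" for j l
    using that
  proof (induction l)
    case (Suc l)
    then have "(p (j + l), p (j + Suc l)) \<in> ?E'" using K.path_arc[of "j + l"] by (simp add: move_arc_def)
    then show ?case using Suc by (auto intro: rtrancl_into_rtrancl)
  qed simp
  have "(?x, ?z) \<in> ?E'\<^sup>*" using walk[of i "m - i - i"] i by simp
  then have xw: "(?x, w) \<in> ?E'\<^sup>*"
    by (rule rtrancl_into_rtrancl) (simp add: move_arc_def)
  have "sym ?E'" unfolding sym_def using E'.sym_iff by blast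
  then have "(w, ?x) \<in> ?E'\<^sup>*" using xw sym_rtrancl[of ?E'] by (auto dest: symD)
  with xw have "E \<subseteq> ?E'\<^sup>*" by (auto simp: move_arc_def)
  then have sub: "E\<^sup>* \<subseteq> ?E'\<^sup>*" using rtrancl_subset_rtrancl by blast
  have "card E = card ?K + 2"
    using arc sym_arcs[OF arc] ne by (subst E, subst card_Un_disjoint) auto
  moreover have "card ?E' = card ?K + 2"
    unfolding move_arc_def using nonadj ne sym_iff[of ?z w]
    by (subst card_Un_disjoint) auto
  ultimately show "unicyclic_graph V ?E'"
    using nonempty conn card_arcs sub by unfold_locales auto
qed

lemma (in pendant_path) pendant_path_subgraph:
  assumes "simple_graph V F" "\<And>j. 0 < j \<Longrightarrow> j \<le> m \<Longrightarrow> F `` {p j} = E `` {p j}"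
  shows "pendant_path V F p m"
proof -
  interpret F: simple_graph V F by fact
  show ?thesis
    by unfold_locales (use assms(2) path_inj path_interior path_end path_length in auto)
qed

text \<open>
  For a unicyclic graph this degree pattern characterises the cycle with one pendent vertex.
  Stated by degrees, it is what remains when no edge can be moved.
\<close>

definition short_tadpole :: "'a set \<Rightarrow> 'a rel \<Rightarrow> bool" where
  "short_tadpole V E \<longleftrightarrow> (\<exists>z x. E `` {z} = {x} \<and> card (E `` {x}) = 3
     \<and> (\<forall>v\<in>V. v \<noteq> z \<longrightarrow> v \<noteq> x \<longrightarrow> card (E `` {v}) = 2))"

text \<open>
  An edge \<open>p 0\<close>, \<open>w\<close> that does not belong to the pendant path from \<open>p 0\<close> to \<open>z\<close> is moved to \<open>z\<close>. The
  leaf \<open>z\<close> is lost, but \<open>y\<close> stays a leaf.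
\<close>

lemma (in unicyclic_graph) reduce_two_leaves:
  assumes z: "card (E `` {z}) = 1" and y: "card (E `` {y}) = 1" "y \<noteq> z"
  shows "\<exists>F. unicyclic_graph V F \<and> has_leaf F
    \<and> SLEE \<lparr>pverts = V, parcs = F\<rparr> < SLEE \<lparr>pverts = V, parcs = E\<rparr>"
proof -
  obtain p m where path: "pendant_path V E p m" and pm: "p m = z" and deg: "3 \<le> card (E `` {p 0})"
    using leaf_pendant_path[OF z] .
  interpret P: pendant_path V E p m by (rule path)
  have p1: "p 1 \<in> E `` {p 0}" using P.path_arc[of 0] P.path_length by simp
  have "card (E `` {p 0} - {p 1}) \<noteq> 0" using deg p1 by (simp add: card_Diff_singleton)
  then obtain w where w: "w \<in> E `` {p 0}" "w \<noteq> p 1"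
    by (metis Diff_iff card.empty equals0I insertCI)
  then have off: "w \<notin> p ` {..m}" by (rule P.nbr_of_start_off_path)
  let ?K = "E - {(p 0, w), (w, p 0)}"
  have "pendant_path V ?K p m"
  proof (rule P.pendant_path_subgraph[OF simple_graph_remove_edge])
    fix j assume j: "0 < j" "j \<le> m"
    then have "p j \<noteq> p 0" "p j \<noteq> w" using off P.path_eq_iff[of j 0] by auto
    then show "?K `` {p j} = E `` {p j}" by auto
  qed
  moreover have "(p (m - 0), w) \<notin> E"
    using P.path_end off P.path_length by auto
  moreover have "2 \<le> card (?K `` {p 0})"
  proof -
    have "?K `` {p 0} = E `` {p 0} - {w}" using w no_loop by auto
    then show ?thesis using w deg by (simp add: card_Diff_singleton)
  qed
  ultimately have *: "unicyclic_graph V (move_arc E w (p 0) (p (m - 0)))"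
      "SLEE \<lparr>pverts = V, parcs = move_arc E w (p 0) (p (m - 0))\<rparr> < SLEE \<lparr>pverts = V, parcs = E\<rparr>"
    using w off P.path_length slide[where p = p and i = 0 and w = w and m = m] by simp_all
  have "card (move_arc E w (p 0) (p m) `` {y}) = card (E `` {y})"
    using w y pm deg off P.path_end by (intro card_nbrs_move_arc) auto
  then have "has_leaf (move_arc E w (p 0) (p m))" using y by (auto simp: has_leaf_def)
  with * show ?thesis by auto
qed

text \<open>
  Counting degrees shows that the attachment vertex \<open>p 0\<close> has degree 3 and all vertices other than
  it and \<open>z\<close> have degree 2. Let \<open>w\<close> and \<open>w'\<close> be the neighbours of \<open>p 0\<close> off the pendant path. Without the
  edge to \<open>w\<close>, the path \<open>w', p 0, \<dots>, p m\<close> is pendant at \<open>w'\<close>, and the mirror image of \<open>p 0\<close> in it is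
  \<open>p (m - 1)\<close>. Moving the edge there leaves \<open>z\<close> a leaf.
\<close>

lemma (in unicyclic_graph) reduce_one_leaf:
  assumes z: "card (E `` {z}) = 1" and unique: "\<And>y. card (E `` {y}) = 1 \<Longrightarrow> y = z"
    and not_short: "\<not> short_tadpole V E"
  shows "\<exists>F. unicyclic_graph V F \<and> has_leaf F
    \<and> SLEE \<lparr>pverts = V, parcs = F\<rparr> < SLEE \<lparr>pverts = V, parcs = E\<rparr>"
proof -
  obtain p m where path: "pendant_path V E p m" and pm: "p m = z" and deg: "3 \<le> card (E `` {p 0})"
    using leaf_pendant_path[OF z] .
  interpret P: pendant_path V E p m by (rule path)
  let ?x = "p 0"
  have zV: "z \<in> V" and xV: "?x \<in> V" using leaf_in_V[OF z] P.path_in_V by auto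
  have "?x \<noteq> z" using z deg by auto
  have deg2: "2 \<le> card (E `` {v})" if "v \<in> V" "v \<noteq> z" for v
    using degree_pos[OF leaf_card_V[OF z] that(1)] unique[of v] that(2) by linarith
  have sum_rest: "(\<Sum>v\<in>V - {z, ?x}. card (E `` {v})) + card (E `` {?x}) + 1 = 2 * card V"
  proof -
    have "(\<Sum>v\<in>V. card (E `` {v})) = (\<Sum>v\<in>V - {z, ?x}. card (E `` {v})) + (\<Sum>v\<in>{z, ?x}. card (E `` {v}))"
      using zV xV finite_verts by (intro sum.subset_diff) auto
    then show ?thesis using z \<open>?x \<noteq> z\<close> sum_degrees card_arcs by simp
  qed
  have card_rest: "card (V - {z, ?x}) + 2 = card V"
    using zV xV \<open>?x \<noteq> z\<close> card_mono[OF finite_verts, of "{z, ?x}"] finite_verts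
    by (simp add: card_Diff_subset)
  have ge: "(\<Sum>v\<in>V - {z, ?x}. 2) \<le> (\<Sum>v\<in>V - {z, ?x}. card (E `` {v}))"
    using deg2 by (intro sum_mono) auto
  have degx: "card (E `` {?x}) = 3"
    using sum_rest card_rest ge deg by simp
  have rest: "card (E `` {v}) = 2" if "v \<in> V" "v \<noteq> z" "v \<noteq> ?x" for v
  proof (rule ccontr)
    assume "card (E `` {v}) \<noteq> 2"
    then have "2 < card (E `` {v})" using deg2[of v] that by simp
    then have "(\<Sum>v\<in>V - {z, ?x}. 2) < (\<Sum>v\<in>V - {z, ?x}. card (E `` {v}))"
      using deg2 that finite_verts by (intro sum_strict_mono_ex1) auto
    then show False using sum_rest card_rest degx by simp
  qed
  have m: "2 \<le> m"
  proof (rule ccontr)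
    assume "\<not> 2 \<le> m"
    then have "m = 1" using P.path_length by simp
    then have "E `` {z} = {?x}" using P.path_end pm by simp
    then have "short_tadpole V E" unfolding short_tadpole_def using degx rest by blast
    then show False using not_short by simp
  qed
  have p1: "p 1 \<in> E `` {?x}" using P.path_arc[of 0] P.path_length by simp
  then have "card (E `` {?x} - {p 1}) = 2" using degx by (simp add: card_Diff_singleton)
  then obtain w w' where ww: "E `` {?x} - {p 1} = {w, w'}" "w \<noteq> w'" by (auto simp: card_2_iff)
  then have nbrs: "E `` {?x} = {p 1, w, w'}" "w \<noteq> p 1" "w' \<noteq> p 1" using p1 by auto
  then have "w \<in> E `` {?x}" "w' \<in> E `` {?x}" by auto
  then have off: "w \<notin> p ` {..m}" "w' \<notin> p ` {..m}"
    using nbrs(2,3) P.nbr_of_start_off_path by blast+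
  define r where "r j = (if j = 0 then w' else p (j - 1))" for j
  have r: "r 0 = w'" "r (Suc j) = p j" for j by (simp_all add: r_def)
  let ?K = "E - {(?x, w), (w, ?x)}"
  have K_nbrs: "?K `` {p j} = E `` {p j}" if "0 < j" "j \<le> m" for j
  proof -
    have "p j \<noteq> ?x" "p j \<noteq> w" using off that P.path_eq_iff[of j 0] by auto
    then show ?thesis by auto
  qed
  have xw: "(?x, w) \<in> E" "(?x, w') \<in> E" using nbrs by auto
  have K_x: "?K `` {?x} = {w', p 1}" using nbrs ww no_loop[of ?x] by auto
  interpret K: simple_graph V ?K by (rule simple_graph_remove_edge)
  have "pendant_path V ?K r (Suc m)"
  proof
    show "inj_on r {..Suc m}"
    proof (rule inj_onI)
      fix i j assume ij: "i \<in> {..Suc m}" "j \<in> {..Suc m}" "r i = r j"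
      have "p k \<noteq> w'" "w' \<noteq> p k" if "k \<le> m" for k using off(2) that by auto
      then show "i = j" using ij P.path_eq_iff[of "i - 1" "j - 1"] by (cases i; cases j) (auto simp: r)
    qed
    show "?K `` {r j} = {r (j - 1), r (Suc j)}" if j: "0 < j" "j < Suc m" for j
    proof -
      obtain k where k: "j = Suc k" using j by (cases j) auto
      show ?thesis
      proof (cases k)
        case 0
        then show ?thesis using K_x k by (simp add: r numeral_2_eq_2)
      next
        case (Suc l)
        then show ?thesis using K_nbrs[of k] P.path_interior[of k] j k by (simp add: r)
      qed
    qed
    show "?K `` {r (Suc m)} = {r (Suc m - 1)}"
      using K_nbrs[of m] P.path_end m by (cases m) (auto simp: r)
  qed simp
  then have path': "pendant_path V (E - {(r 1, w), (w, r 1)}) r (Suc m)"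
    using r(2)[of 0] by simp
  have off': "w \<notin> r ` {..Suc m}"
  proof
    assume "w \<in> r ` {..Suc m}"
    then obtain j where "j \<le> Suc m" "w = r j" by auto
    then show False using off(1) ww(2) by (cases j) (auto simp: r)
  qed
  have target: "r (Suc m - 1) = p (m - 1)" using m r(2)[of "m - 1"] by simp
  have nonadj: "(p (m - 1), w) \<notin> E"
  proof
    assume "(p (m - 1), w) \<in> E"
    then have "w \<in> {p (m - 1 - 1), p (Suc (m - 1))}"
      using P.path_interior[of "m - 1"] m by auto
    then show False using off(1) m by auto
  qed
  have w'V: "w' \<in> V" "w' \<noteq> z" "w' \<noteq> ?x"
    using nbr_in_V[of w' ?x] nbrs off(2) pm no_loop by auto
  have "?K `` {w'} = E `` {w'}" using ww(2) w'V by auto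
  then have "2 \<le> card (?K `` {w'})" using rest[of w'] w'V by simp
  then have "2 \<le> card ((E - {(r 1, w), (w, r 1)}) `` {r 0})" using r(1) r(2)[of 0] by simp
  then have *: "unicyclic_graph V (move_arc E w (r 1) (r (Suc m - 1)))"
      "SLEE \<lparr>pverts = V, parcs = move_arc E w (r 1) (r (Suc m - 1))\<rparr> < SLEE \<lparr>pverts = V, parcs = E\<rparr>"
    using slide[OF path' _ _ off'] m xw r(2)[of 0] nonadj target by auto
  have "z \<noteq> p (m - 1)" using pm P.path_eq_iff[of m "m - 1"] m by auto
  moreover have "w \<noteq> ?x" "w \<noteq> p (m - 1)" using off(1) by auto
  ultimately have "card (move_arc E w ?x (p (m - 1)) `` {z}) = card (E `` {z})"
    using xw nonadj \<open>?x \<noteq> z\<close> by (intro card_nbrs_move_arc) auto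
  then have "has_leaf (move_arc E w (r 1) (r (Suc m - 1)))"
    using z target r(2)[of 0] by (auto simp: has_leaf_def)
  with * show ?thesis by blast
qed

lemma (in unicyclic_graph) reduce:
  assumes "has_leaf E" "\<not> short_tadpole V E"
  shows "\<exists>F. unicyclic_graph V F \<and> has_leaf F
    \<and> SLEE \<lparr>pverts = V, parcs = F\<rparr> < SLEE \<lparr>pverts = V, parcs = E\<rparr>"
  using assms reduce_two_leaves reduce_one_leaf unfolding has_leaf_def by blast

text \<open>
  A graph of least index among the finitely many unicyclic graphs with a leaf on \<open>V\<close> cannot be
  reduced.
\<close>

lemma (in unicyclic_graph) descend:
  assumes "has_leaf E"
  obtains H where "unicyclic_graph V H" "short_tadpole V H"
    "SLEE \<lparr>pverts = V, parcs = H\<rparr> \<le> SLEE \<lparr>pverts = V, parcs = E\<rparr>"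
    "\<not> short_tadpole V E \<Longrightarrow> SLEE \<lparr>pverts = V, parcs = H\<rparr> < SLEE \<lparr>pverts = V, parcs = E\<rparr>"
proof -
  let ?S = "\<lambda>F. SLEE \<lparr>pverts = V, parcs = F\<rparr>"
  define \<F> where "\<F> = {F. unicyclic_graph V F \<and> has_leaf F}"
  have "\<F> \<subseteq> Pow (V \<times> V)"
    unfolding \<F>_def using simple_graph.arcs_subset unicyclic_graph.axioms(1) by blast
  then have fin: "finite \<F>" using finite_verts by (auto intro: finite_subset)
  have E: "E \<in> \<F>" unfolding \<F>_def using assms unicyclic_graph_axioms by simp
  then have "\<F> \<noteq> {}" by auto
  then obtain H where H: "H \<in> \<F>" and least: "\<And>F. F \<in> \<F> \<Longrightarrow> ?S H \<le> ?S F"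
    using ex_is_arg_min_if_finite[OF fin, of ?S] by (force simp: is_arg_min_linorder)
  have "short_tadpole V H"
    using H least unicyclic_graph.reduce[of V H] unfolding \<F>_def by (metis mem_Collect_eq not_less)
  moreover have "?S H < ?S E" if "\<not> short_tadpole V E"
    using reduce[OF assms that] least unfolding \<F>_def by fastforce
  ultimately show thesis using that H least[OF E] unfolding \<F>_def by blast
qed


section \<open>Cycles\<close>

definition cyclic_seq :: "'a rel \<Rightarrow> nat \<Rightarrow> (nat \<Rightarrow> 'a) \<Rightarrow> bool" where
  "cyclic_seq E k c \<longleftrightarrow> 3 \<le> k \<and> inj_on c {..<k} \<and> (\<forall>j<k. (c j, c (Suc j mod k)) \<in> E)"

lemma (in simple_graph) cyclic_seq_in_V: "cyclic_seq E k c \<Longrightarrow> c ` {..<k} \<subseteq> V"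
  using arcs_subset unfolding cyclic_seq_def by blast

lemma (in simple_graph) cyclic_seq_nbrs:
  assumes c: "cyclic_seq E k c" and v: "v \<in> c ` {..<k}"
  shows "2 \<le> card (E `` {v} \<inter> c ` {..<k})"
proof -
  obtain j where j: "j < k" "v = c j" using v by auto
  have k: "3 \<le> k" using c by (simp add: cyclic_seq_def)
  define s where "s = (if Suc j = k then 0 else Suc j)"
  define t where "t = (if j = 0 then k - 1 else j - 1)"
  have st: "s < k" "t < k" "s \<noteq> t" "s = Suc j mod k" "j = Suc t mod k"
    using j k by (auto simp: s_def t_def)
  have "(v, c s) \<in> E" "(c t, v) \<in> E"
    using c j st unfolding cyclic_seq_def by metis+
  then have "{c s, c t} \<subseteq> E `` {v} \<inter> c ` {..<k}" using st sym_iff[of "c t" v] by auto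
  moreover have "c s \<noteq> c t" using c st by (auto simp: cyclic_seq_def inj_on_def)
  ultimately show ?thesis using card_mono[of "E `` {v} \<inter> c ` {..<k}" "{c s, c t}"] by simp
qed

lemma (in simple_graph) cyclic_seq_closed_at_degree_2:
  assumes "cyclic_seq E k c" "v \<in> c ` {..<k}" "card (E `` {v}) = 2"
  shows "E `` {v} \<subseteq> c ` {..<k}"
proof -
  have "E `` {v} \<inter> c ` {..<k} = E `` {v}"
    using cyclic_seq_nbrs[OF assms(1,2)] assms(3) by (intro card_seteq) auto
  then show ?thesis by auto
qed

text \<open>
  Without a leaf all degrees are at least 2, and as their average is 2 they equal 2. The cycle is
  then closed under neighbours, hence passes through all vertices.
\<close>

lemma (in unicyclic_graph) short_cycle_has_leaf:
  assumes c: "cyclic_seq E k c" and k: "k < card V"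
  shows "has_leaf E"
proof (rule ccontr)
  assume no_leaf: "\<not> has_leaf E"
  have k3: "3 \<le> k" using c by (simp add: cyclic_seq_def)
  have "2 \<le> card (E `` {v})" if "v \<in> V" for v
  proof -
    have "1 \<le> card (E `` {v})" using that k k3 by (intro degree_pos) auto
    moreover have "card (E `` {v}) \<noteq> 1" using no_leaf by (auto simp: has_leaf_def)
    ultimately show ?thesis by simp
  qed
  then have deg: "card (E `` {v}) = 2" if "v \<in> V" for v using that by (intro all_degrees_2)
  have "c ` {..<k} = V"
  proof (rule closed_eq_V[of _ "c 0"])
    show "c ` {..<k} \<subseteq> V" using c by (rule cyclic_seq_in_V)
    show "c 0 \<in> c ` {..<k}" using k3 by simp
    show "E `` {v} \<subseteq> c ` {..<k}" if "v \<in> c ` {..<k}" for v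
      using that cyclic_seq_in_V[OF c] deg by (intro cyclic_seq_closed_at_degree_2[OF c]) auto
  qed
  then have "card V \<le> k" using card_image_le[of "{..<k}" c] by simp
  then show False using k by simp
qed

text \<open>
  The cycle avoids the leaf \<open>z\<close>, and together with \<open>z\<close> it is closed under neighbours: at a vertex of
  degree 2 both neighbours lie on the cycle, and the third neighbour of \<open>x\<close> is \<open>z\<close>.
\<close>

lemma (in unicyclic_graph) short_tadpole_cycle_length:
  assumes "short_tadpole V E" and c: "cyclic_seq E k c"
  shows "Suc k = card V"
proof -
  obtain z x where z: "E `` {z} = {x}" and x: "card (E `` {x}) = 3"
    and rest: "\<And>v. v \<in> V \<Longrightarrow> v \<noteq> z \<Longrightarrow> v \<noteq> x \<Longrightarrow> card (E `` {v}) = 2"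
    using assms(1) unfolding short_tadpole_def by blast
  let ?C = "c ` {..<k}"
  have k: "3 \<le> k" and inj: "inj_on c {..<k}" using c by (simp_all add: cyclic_seq_def)
  have CV: "?C \<subseteq> V" using c by (rule cyclic_seq_in_V)
  have zC: "z \<notin> ?C"
  proof
    assume "z \<in> ?C"
    then have "2 \<le> card ({x} \<inter> ?C)" using cyclic_seq_nbrs[OF c, of z] z by simp
    then show False using card_mono[of "{x}" "{x} \<inter> ?C"] by simp
  qed
  have zV: "z \<in> V" "(x, z) \<in> E" using z nbr_in_V[of x z] sym_arcs[of z x] by auto
  have x_nbrs: "E `` {x} \<subseteq> insert z ?C" if "x \<in> ?C"
  proof -
    have "3 \<le> card (insert z (E `` {x} \<inter> ?C))"
      using zC cyclic_seq_nbrs[OF c that] by simp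
    then have "insert z (E `` {x} \<inter> ?C) = E `` {x}"
      using x zV by (intro card_seteq) auto
    then show ?thesis by auto
  qed
  have step: "E `` {v} \<subseteq> insert z ?C" if "v \<in> ?C" for v
  proof (cases "v = x")
    case True
    then show ?thesis using x_nbrs that by simp
  next
    case False
    then have "card (E `` {v}) = 2" using rest[of v] that CV zC by auto
    then show ?thesis using cyclic_seq_closed_at_degree_2[OF c that] by auto
  qed
  have xC: "x \<in> ?C"
  proof (rule ccontr)
    assume "x \<notin> ?C"
    have "?C = V"
    proof (rule closed_eq_V[OF CV, of "c 0"])
      show "c 0 \<in> ?C" using k by simp
      show "E `` {v} \<subseteq> ?C" if "v \<in> ?C" for v
        using that \<open>x \<notin> ?C\<close> rest[of v] CV zC
        by (intro cyclic_seq_closed_at_degree_2[OF c]) auto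
    qed
    then show False using zV zC by simp
  qed
  have "insert z ?C = V"
    using CV zV z xC step by (intro closed_eq_V[of _ z]) auto
  moreover have "card (insert z ?C) = Suc k" using zC inj by (simp add: card_image)
  ultimately show ?thesis by simp
qed

text \<open>
  The last vertex of a longest path in \<open>U\<close> has a second neighbour in \<open>U\<close>, which by maximality lies on
  the path and closes a cycle.
\<close>

lemma (in simple_graph) ex_cyclic_seq:
  assumes U: "U \<subseteq> V" "u \<in> U" and deg: "\<And>v. v \<in> U \<Longrightarrow> 2 \<le> card (E `` {v} \<inter> U)"
  shows "\<exists>k c. cyclic_seq E k c"
proof -
  define P where "P k r \<longleftrightarrow> inj_on r {..k} \<and> r ` {..k} \<subseteq> U \<and> (\<forall>j<k. (r j, r (Suc j)) \<in> E)"
    for k and r :: "nat \<Rightarrow> 'a"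
  have bound: "k \<le> card V" if "P k r" for k r
    using inj_in_V_bound[of r k] that U unfolding P_def by fastforce
  have ex0: "\<exists>r. P 0 r" using U(2) by (intro exI[of _ "\<lambda>_. u"]) (simp add: P_def)
  define k where "k = (GREATEST k. \<exists>r. P k r)"
  have "\<exists>r. P k r"
    unfolding k_def
    by (rule GreatestI_nat[where P = "\<lambda>k. \<exists>r. P k r" and b = "card V", OF ex0]) (use bound in auto)
  then obtain r where r: "P k r" by blast
  have max: "l \<le> k" if "P l r" for l r
    unfolding k_def
    by (rule Greatest_le_nat[where P = "\<lambda>k. \<exists>r. P k r" and b = "card V"]) (use that bound in auto)
  have rU: "r j \<in> U" if "j \<le> k" for j using r that by (auto simp: P_def)
  have arc: "(r j, r (Suc j)) \<in> E" if "j < k" for j using r that by (simp add: P_def)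
  have inj: "inj_on r {..k}" using r by (simp add: P_def)
  have inside: "v \<in> r ` {..k}" if v: "v \<in> E `` {r k} \<inter> U" for v
  proof (rule ccontr)
    assume new: "v \<notin> r ` {..k}"
    have "P (Suc k) (r(Suc k := v))"
      unfolding P_def
    proof (intro conjI allI impI)
      show "inj_on (r(Suc k := v)) {..Suc k}"
        using new inj by (auto simp: inj_on_def le_Suc_eq)
      show "(r(Suc k := v)) ` {..Suc k} \<subseteq> U" using rU v by (auto simp: le_Suc_eq)
      show "((r(Suc k := v)) j, (r(Suc k := v)) (Suc j)) \<in> E" if "j < Suc k" for j
        using that arc[of j] v by (cases "j = k") auto
    qed
    then show False using max by fastforce
  qed
  have "2 \<le> card (E `` {r k} \<inter> U)" using deg rU by simp
  moreover have "card (E `` {r k} \<inter> U) \<le> 1" if "E `` {r k} \<inter> U \<subseteq> {r (k - 1)}"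
    using card_mono[OF _ that] by simp
  ultimately obtain v where v: "v \<in> E `` {r k} \<inter> U" "v \<noteq> r (k - 1)" by fastforce
  then obtain i where i: "i \<le> k" "v = r i" using inside by auto
  have "i \<noteq> k" using v i no_loop by auto
  moreover have "i \<noteq> k - 1" using v i by auto
  ultimately have i2: "i + 2 \<le> k" using i by linarith
  define l where "l = k - i + 1"
  have "cyclic_seq E l (\<lambda>j. r (i + j))"
    unfolding cyclic_seq_def
  proof (intro conjI allI impI)
    show "3 \<le> l" using i2 by (simp add: l_def)
    show "inj_on (\<lambda>j. r (i + j)) {..<l}"
    proof (rule inj_onI)
      fix a b assume "a \<in> {..<l}" "b \<in> {..<l}" "r (i + a) = r (i + b)"
      then show "a = b" using inj_onD[OF inj, of "i + a" "i + b"] i by (simp add: l_def)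
    qed
    fix j assume j: "j < l"
    show "(r (i + j), r (i + Suc j mod l)) \<in> E"
    proof (cases "Suc j = l")
      case True
      then have "i + j = k" using i by (simp add: l_def)
      then show ?thesis using True v i by simp
    next
      case False
      then show ?thesis using j arc[of "i + j"] i by (simp add: l_def)
    qed
  qed
  then show ?thesis by blast
qed

text \<open>
  Deleting the leaf leaves all degrees at least 2.
\<close>

lemma (in unicyclic_graph) short_tadpole_ex_cycle:
  assumes "short_tadpole V E"
  shows "\<exists>k c. cyclic_seq E k c"
proof -
  obtain z x where z: "E `` {z} = {x}" and x: "card (E `` {x}) = 3"
    and rest: "\<And>v. v \<in> V \<Longrightarrow> v \<noteq> z \<Longrightarrow> v \<noteq> x \<Longrightarrow> card (E `` {v}) = 2"
    using assms unfolding short_tadpole_def by blast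
  have "x \<in> V" "x \<noteq> z" using z nbr_in_V[of x z] no_loop by auto
  moreover have "2 \<le> card (E `` {v} \<inter> (V - {z}))" if v: "v \<in> V - {z}" for v
  proof -
    have "E `` {v} \<inter> (V - {z}) = E `` {v} - {z}" using arcs_subset by auto
    moreover have "2 \<le> card (E `` {v} - {z})"
    proof (cases "v = x")
      case True
      then show ?thesis using x diff_card_le_card_Diff[of "{z}" "E `` {v}"] by simp
    next
      case False
      then have "z \<notin> E `` {v}" using z sym_iff[of v z] by auto
      then show ?thesis using rest[of v] v False by simp
    qed
    ultimately show ?thesis by simp
  qed
  ultimately show ?thesis by (intro ex_cyclic_seq[of "V - {z}" x]) auto
qed

section \<open>Invariance under isomorphism\<close>

lemma sl_op_pow_image:
  assumes "inj_on f V" "E \<subseteq> V \<times> V" "\<And>u. u \<in> V \<Longrightarrow> g (f u) = h u" "u \<in> V"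
  shows "(sl_op (map_prod f f ` E) ^^ k) g (f u) = (sl_op E ^^ k) h u"
  using assms(4)
proof (induction k arbitrary: u)
  case 0
  then show ?case using assms(3) by simp
next
  case (Suc k)
  have nbrs: "(map_prod f f ` E) `` {f u} = f ` (E `` {u})"
    using assms(1,2) Suc.prems by (auto simp: inj_on_def image_iff) 
  have "inj_on f (E `` {u})" using assms(1,2) by (rule_tac inj_on_subset[of f V]) auto
  then have "(sl_op (map_prod f f ` E) ^^ Suc k) g (f u)
      = (\<Sum>v\<in>E `` {u}. (sl_op (map_prod f f ` E) ^^ k) g (f u)
          + (sl_op (map_prod f f ` E) ^^ k) g (f v))"
    by (simp add: sl_op_def[of "map_prod f f ` E" _ "f u"] nbrs sum.reindex card_image)
  also have "\<dots> = (\<Sum>v\<in>E `` {u}. (sl_op E ^^ k) h u + (sl_op E ^^ k) h v)"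
    using assms(2) Suc.prems by (intro sum.cong refl) (auto simp: Suc.IH)
  also have "\<dots> = (sl_op E ^^ Suc k) h u" by (simp add: sl_op_def)
  finally show ?case .
qed

lemma SLEE_eq_if_iso:
  assumes G: "simple_graph (pverts G) (parcs G)"
    and f: "bij_betw f (pverts G) (pverts H)" and H: "parcs H = map_prod f f ` parcs G"
  shows "SLEE G = SLEE H"
proof -
  interpret simple_graph "pverts G" "parcs G" by (rule G)
  have inj: "inj_on f (pverts G)" and img: "f ` pverts G = pverts H"
    using f by (simp_all add: bij_betw_def)
  have "simple_graph (pverts H) (parcs H)"
  proof
    show "finite (pverts H)" using finite_verts by (simp flip: img)
    show "parcs H \<subseteq> pverts H \<times> pverts H" using arcs_subset by (auto simp: H simp flip: img)
    show "(v, u) \<in> parcs H" if uv: "(u, v) \<in> parcs H" for u v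
    proof -
      obtain a b where "(a, b) \<in> parcs G" "u = f a" "v = f b" using uv by (auto simp: H)
      then have "(b, a) \<in> parcs G" by (simp add: sym_arcs)
      then show ?thesis using \<open>u = f a\<close> \<open>v = f b\<close> by (force simp: H)
    qed
    show "(u, u) \<notin> parcs H" for u
    proof
      assume "(u, u) \<in> parcs H"
      then obtain a b where ab: "(a, b) \<in> parcs G" "f a = f b" by (auto simp: H)
      then have "a = b" using inj arcs_subset by (auto simp: inj_on_def)
      then show False using ab no_loop by simp
    qed
  qed
  moreover have "moment (pverts H) (sl_op (parcs H)) k = moment (pverts G) (sl_op (parcs G)) k" for k
  proof -
    have "moment (pverts H) (sl_op (parcs H)) k
        = (\<Sum>v\<in>pverts G. (sl_op (parcs H) ^^ k) (\<lambda>u. of_bool (u = f v)) (f v))"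
      unfolding moment_def using f by (rule sum.reindex_bij_betw[symmetric])
    also have "\<dots> = (\<Sum>v\<in>pverts G. (sl_op (parcs G) ^^ k) (\<lambda>u. of_bool (u = v)) v)"
    proof (intro sum.cong refl)
      fix v assume "v \<in> pverts G"
      then show "(sl_op (parcs H) ^^ k) (\<lambda>u. of_bool (u = f v)) (f v)
          = (sl_op (parcs G) ^^ k) (\<lambda>u. of_bool (u = v)) v"
        unfolding H using inj by (intro sl_op_pow_image[OF inj arcs_subset]) (auto simp: inj_on_eq_iff)
    qed
    finally show ?thesis by (simp add: moment_def)
  qed
  ultimately have "(\<lambda>k. moment (pverts G) (sl_op (parcs G)) k / fact k) sums SLEE H"
    using SLEE_sums[of H] by simp
  then show ?thesis using SLEE_sums[OF G] sums_unique2 by blast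
qed

lemma graph_isoD:
  assumes "graph_iso G H"
  shows "\<exists>f. bij_betw f (pverts G) (pverts H) \<and> parcs H = map_prod f f ` parcs G"
proof -
  obtain h where h: "pre_digraph.digraph_isomorphism (with_proj G) h"
    and H: "with_proj H = app_iso h (with_proj G)"
    using assms unfolding graph_iso_def digraph_iso_def by blast
  have "verts (with_proj H) = iso_verts h ` pverts G" "arcs (with_proj H) = iso_arcs h ` parcs G"
    "tail (with_proj H) = iso_tail h" "head (with_proj H) = iso_head h"
    unfolding H by simp_all
  then have H': "pverts H = iso_verts h ` pverts G" "parcs H = iso_arcs h ` parcs G"
    "iso_tail h = fst" "iso_head h = snd" by simp_all
  have iso: "inj_on (iso_verts h) (pverts G)"
    "\<And>a. a \<in> parcs G \<Longrightarrow> iso_verts h (fst a) = iso_tail h (iso_arcs h a)"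
    "\<And>a. a \<in> parcs G \<Longrightarrow> iso_verts h (snd a) = iso_head h (iso_arcs h a)"
    using h unfolding pre_digraph.digraph_isomorphism_def by simp_all
  have "iso_arcs h a = map_prod (iso_verts h) (iso_verts h) a" if "a \<in> parcs G" for a
    using iso(2,3)[OF that] H'(3,4) by (simp add: prod_eq_iff)
  then have "parcs H = map_prod (iso_verts h) (iso_verts h) ` parcs G"
    unfolding H'(2) by (rule image_cong[OF refl])
  then show ?thesis using iso(1) H'(1) by (auto simp: bij_betw_def)
qed

lemma graph_isoI:
  assumes G: "simple_graph (pverts G) (parcs G)"
    and f: "bij_betw f (pverts G) (pverts H)" and H: "parcs H = map_prod f f ` parcs G"
  shows "graph_iso G H"
proof -
  interpret simple_graph "pverts G" "parcs G" by (rule G)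
  \<comment> \<open>Arcs are pairs, so an isomorphism acts on them componentwise and keeps the projections as tail and
    head.\<close>
  define h where "h = \<lparr>iso_verts = f, iso_arcs = map_prod f f, iso_head = snd, iso_tail = fst\<rparr>"
  have "wf_digraph (with_proj G)" using arcs_subset by unfold_locales auto
  moreover have "inj_on (map_prod f f) (parcs G)"
    using bij_betw_imp_inj_on[OF f] by (intro inj_on_subset[OF map_prod_inj_on arcs_subset])
  ultimately have "pre_digraph.digraph_isomorphism (with_proj G) h"
    using bij_betw_imp_inj_on[OF f] by (simp add: pre_digraph.digraph_isomorphism_def h_def)
  moreover have "with_proj H = app_iso h (with_proj G)"
    using bij_betw_imp_surj_on[OF f] H by (simp add: with_proj_def app_iso_def h_def)
  ultimately show ?thesis unfolding graph_iso_def digraph_iso_def by blast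
qed


section \<open>The cycle with one pendent vertex\<close>

lemma cycle_graph_arcs:
  "parcs (cycle_graph m) = (\<lambda>j. (j, Suc j mod m)) ` {..<m} \<union> (\<lambda>j. (Suc j mod m, j)) ` {..<m}"
  by (auto simp: cycle_graph_def)

lemma card_cycle_graph_arcs:
  assumes "3 \<le> m"
  shows "card (parcs (cycle_graph m)) = 2 * m"
proof -
  let ?A = "(\<lambda>j. (j, Suc j mod m)) ` {..<m}" and ?B = "(\<lambda>j. (Suc j mod m, j)) ` {..<m}"
  have "?A \<inter> ?B = {}"
  proof -
    have no_2_cycle: False if "i < m" "j < m" "j = Suc i mod m" "i = Suc j mod m" for i j
    proof -
      have wrap: "Suc x = m \<and> Suc x mod m = 0 \<or> Suc x mod m = Suc x" if "x < m" for x
        using that by (cases "Suc x = m") auto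
      show False
        using wrap[OF that(1)] wrap[OF that(2)] that(3,4) assms by (elim disjE conjE) linarith+
    qed
    show ?thesis
    proof (rule equals0I)
      fix a assume "a \<in> ?A \<inter> ?B"
      then obtain i j where ij: "i < m" "j < m" and a: "a = (i, Suc i mod m)" "a = (Suc j mod m, j)"
        by blast
      from a have "(i, Suc i mod m) = (Suc j mod m, j)" by (rule trans[OF sym])
      then have eq: "i = Suc j mod m" "Suc i mod m = j" by (iprover elim: Pair_inject)+
      show False by (rule no_2_cycle[OF ij eq(2)[symmetric] eq(1)])
    qed
  qed
  then have "card (?A \<union> ?B) = card ?A + card ?B" by (intro card_Un_disjoint) auto
  moreover have "card ?A = m" "card ?B = m" by (simp_all add: card_image inj_on_def)
  ultimately show ?thesis by (simp add: cycle_graph_arcs)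
qed

lemma pendent_cycle_graph_Suc:
  "pverts (pendent_cycle_graph (Suc k)) = {..<Suc k}"
  "parcs (pendent_cycle_graph (Suc k)) = parcs (cycle_graph k) \<union> {(0, k), (k, 0)}"
  by (auto simp: pendent_cycle_graph_def attach_pendent_def cycle_graph_def)

lemma simple_graph_pendent_cycle_graph:
  assumes "3 \<le> k"
  shows "simple_graph {..<Suc k} (parcs (pendent_cycle_graph (Suc k)))"
proof
  show "(u, u) \<notin> parcs (pendent_cycle_graph (Suc k))" for u
    using assms by (cases "Suc u = k") (auto simp: pendent_cycle_graph_Suc cycle_graph_def)
qed (use assms in \<open>auto simp: pendent_cycle_graph_Suc cycle_graph_def intro!: less_SucI mod_less_divisor\<close>)

text \<open>
  The cycle misses a single vertex \<open>z\<close>, which is joined to some cycle vertex \<open>x\<close>. Starting the cycle at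
  \<open>x\<close> embeds the cycle with a pendent vertex into the graph, and as both have \<open>2 * Suc k\<close> arcs, the
  embedding hits all of them.
\<close>

lemma (in unicyclic_graph) long_cycle_iso_pendent_cycle_graph:
  assumes c: "cyclic_seq E k c" and k: "Suc k = card V"
  obtains f where "bij_betw f {..<Suc k} V" "E = map_prod f f ` parcs (pendent_cycle_graph (Suc k))"
proof -
  let ?C = "c ` {..<k}"
  have k3: "3 \<le> k" and inj: "inj_on c {..<k}" using c by (simp_all add: cyclic_seq_def)
  have CV: "?C \<subseteq> V" using c by (rule cyclic_seq_in_V)
  have "card (V - ?C) = 1"
    using k inj CV finite_verts by (simp add: card_Diff_subset card_image)
  then obtain z where "V - ?C = {z}" by (auto simp: card_1_singleton_iff)
  then have V: "V = insert z ?C" and zC: "z \<notin> ?C" using CV by auto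
  have "E `` {z} \<noteq> {}" using degree_pos[of z] k k3 V by auto
  then obtain x where xz: "(x, z) \<in> E" using sym_arcs by blast
  then have "x \<in> ?C" using V arcs_subset no_loop by auto
  then obtain a where a: "a < k" "x = c a" by auto
  have shift: "(a + j) mod k = (if a + j < k then a + j else a + j - k)" if "j < k" for j
    using a that by (simp add: mod_if)
  define f where "f j = (if j = k then z else c ((a + j) mod k))" for j
  have f0: "f 0 = x" "f k = z" using a k3 by (simp_all add: f_def)
  have fC: "f j \<in> ?C" if "j < k" for j using that k3 by (simp add: f_def)
  have inj_f: "inj_on f {..<Suc k}"
  proof (rule inj_onI)
    fix i j assume ij: "i \<in> {..<Suc k}" "j \<in> {..<Suc k}" "f i = f j"
    consider "i = k \<or> j = k" | "i < k" "j < k" using ij by force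
    then show "i = j"
    proof cases
      case 1
      then show ?thesis using ij f0 fC[of i] fC[of j] zC by (cases "i = k"; cases "j = k") auto
    next
      case 2
      then have "(a + i) mod k = (a + j) mod k"
        using ij(3) inj k3 by (auto simp: f_def inj_on_def)
      then show ?thesis using 2 a by (auto simp: shift split: if_splits)
    qed
  qed
  have "f ` {..<Suc k} \<subseteq> V" using fC f0 V by (auto simp: less_Suc_eq)
  then have "f ` {..<Suc k} = V"
    using inj_f k finite_verts by (intro card_seteq) (simp_all add: card_image)
  then have bij: "bij_betw f {..<Suc k} V" using inj_f by (simp add: bij_betw_def)
  let ?P = "parcs (pendent_cycle_graph (Suc k))"
  interpret P: simple_graph "{..<Suc k}" ?P by (rule simple_graph_pendent_cycle_graph[OF k3])
  have arc: "(f j, f (Suc j mod k)) \<in> E" if "j < k" for j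
  proof -
    have "f (Suc j mod k) = c (Suc ((a + j) mod k) mod k)"
    proof -
      have "Suc j mod k \<noteq> k" using mod_less_divisor[of k "Suc j"] k3 by linarith
      then show ?thesis by (simp add: f_def mod_simps)
    qed
    moreover have "(a + j) mod k < k" using k3 by simp
    ultimately show ?thesis using c that by (simp add: f_def cyclic_seq_def)
  qed
  have sub: "map_prod f f ` ?P \<subseteq> E"
    using arc sym_arcs[OF arc] xz sym_arcs[OF xz] f0
    by (auto simp: pendent_cycle_graph_Suc cycle_graph_arcs)
  have "card ?P = 2 * Suc k"
  proof -
    have "parcs (cycle_graph k) \<inter> {(0, k), (k, 0)} = {}" by (auto simp: cycle_graph_def)
    moreover have "card {(0, k), (k, 0)} = 2" using k3 by simp
    moreover have "finite (parcs (cycle_graph k))" by (simp add: cycle_graph_arcs)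
    ultimately show ?thesis
      by (simp add: pendent_cycle_graph_Suc(2) card_Un_disjoint card_cycle_graph_arcs[OF k3] del: Un_insert_right)
  qed
  moreover have "inj_on (map_prod f f) ?P"
    using inj_f by (intro inj_on_subset[OF map_prod_inj_on P.arcs_subset])
  ultimately have "card (map_prod f f ` ?P) = card E"
    using card_arcs k by (simp add: card_image)
  then have "map_prod f f ` ?P = E" using sub by (intro card_subset_eq) auto
  then show thesis using that bij by blast
qed

text \<open>
  Removing the cycle edge between \<open>0\<close> and \<open>w = k - 1\<close> from the cycle with the pendent vertex \<open>k\<close>
  leaves the pendant path \<open>0, k\<close> of length 1. Joining \<open>w\<close> to \<open>0\<close> restores that graph, and joining \<open>w\<close> to \<open>k\<close> closes the
  cycle through all vertices.
\<close>

lemma SLEE_cycle_graph_less: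
  assumes k: "3 \<le> k"
  shows "SLEE (cycle_graph (Suc k)) < SLEE (pendent_cycle_graph (Suc k))"
proof -
  let ?V = "{..<Suc k}" and ?P = "parcs (pendent_cycle_graph (Suc k))"
  let ?w = "k - 1" and ?p = "\<lambda>j::nat. if j = 0 then 0 else k"
  let ?K = "?P - {(0, ?w), (?w, 0)}"
  interpret P: simple_graph ?V ?P by (rule simple_graph_pendent_cycle_graph[OF k])
  interpret K: simple_graph ?V ?K by (rule P.simple_graph_remove_edge)
  have arcs: "(i, j) \<in> parcs (cycle_graph m) \<longleftrightarrow> i < m \<and> j < m \<and>
      (j = Suc i \<or> i = Suc j \<or> (i = 0 \<and> Suc j = m) \<or> (j = 0 \<and> Suc i = m))" for i j m
  proof -
    have "j = Suc i mod m \<longleftrightarrow> (j = Suc i \<or> (j = 0 \<and> Suc i = m))" if "i < m" "j < m" for i j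
      using that by (cases "Suc i = m") auto
    then have "i < m \<and> j < m \<longrightarrow> (j = Suc i mod m \<or> i = Suc j mod m \<longleftrightarrow>
        j = Suc i \<or> i = Suc j \<or> (i = 0 \<and> Suc j = m) \<or> (j = 0 \<and> Suc i = m))"
      by metis
    moreover have "(i, j) \<in> parcs (cycle_graph m) \<longleftrightarrow>
        i < m \<and> j < m \<and> (j = Suc i mod m \<or> i = Suc j mod m)"
      unfolding cycle_graph_def by simp
    ultimately show ?thesis by blast
  qed
  have P: "(i, j) \<in> ?P \<longleftrightarrow> (i, j) \<in> parcs (cycle_graph k) \<or> (i = 0 \<and> j = k) \<or> (i = k \<and> j = 0)" for i j
    unfolding pendent_cycle_graph_Suc by auto
  interpret pendant_path ?V ?K ?p 1
  proof
    show "inj_on ?p {..1}" using k by (auto simp: inj_on_def)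
    show "?K `` {?p 1} = {?p (1 - 1)}" using k by (auto simp: P arcs)
  qed auto
  have "{1, k} \<subseteq> ?K `` {0}" using k by (auto simp: P arcs)
  then have "2 \<le> card (?K `` {?p 0})" using card_mono[of "?K `` {0}" "{1, k}"] k by simp
  moreover have "(?p 0, ?w) \<notin> ?K" "(?p 1, ?w) \<notin> ?K" "?w \<notin> ?p ` {..1}" using k by (auto simp: P arcs)
  ultimately have "SLEE \<lparr>pverts = ?V, parcs = ?K \<union> {(?p (1 - 0), ?w), (?w, ?p (1 - 0))}\<rparr>
      < SLEE \<lparr>pverts = ?V, parcs = ?K \<union> {(?p 0, ?w), (?w, ?p 0)}\<rparr>"
    by (intro SLEE_slide) auto
  moreover have "\<lparr>pverts = ?V, parcs = ?K \<union> {(?p (1 - 0), ?w), (?w, ?p (1 - 0))}\<rparr> = cycle_graph (Suc k)"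
  proof (rule pair_pre_digraph.equality)
    show "pverts \<lparr>pverts = ?V, parcs = ?K \<union> {(?p (1 - 0), ?w), (?w, ?p (1 - 0))}\<rparr>
        = pverts (cycle_graph (Suc k))" by (simp add: cycle_graph_def)
    have "(i, j) \<in> ?K \<union> {(?p (1 - 0), ?w), (?w, ?p (1 - 0))} \<longleftrightarrow> (i, j) \<in> parcs (cycle_graph (Suc k))" for i j
      using k unfolding P arcs Diff_iff Un_iff by auto
    then have "?K \<union> {(?p (1 - 0), ?w), (?w, ?p (1 - 0))} = parcs (cycle_graph (Suc k))"
      by (intro equalityI subrelI) blast+
    then show "parcs \<lparr>pverts = ?V, parcs = ?K \<union> {(?p (1 - 0), ?w), (?w, ?p (1 - 0))}\<rparr>
        = parcs (cycle_graph (Suc k))" by (simp only: pair_pre_digraph.select_convs)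
  qed simp
  moreover have "\<lparr>pverts = ?V, parcs = ?K \<union> {(?p 0, ?w), (?w, ?p 0)}\<rparr> = pendent_cycle_graph (Suc k)"
  proof (rule pair_pre_digraph.equality)
    show "pverts \<lparr>pverts = ?V, parcs = ?K \<union> {(?p 0, ?w), (?w, ?p 0)}\<rparr>
        = pverts (pendent_cycle_graph (Suc k))" by (simp add: pendent_cycle_graph_Suc)
    have "(0, ?w) \<in> ?P" "(?w, 0) \<in> ?P" using k by (auto simp: P arcs)
    then show "parcs \<lparr>pverts = ?V, parcs = ?K \<union> {(?p 0, ?w), (?w, ?p 0)}\<rparr>
        = parcs (pendent_cycle_graph (Suc k))" by auto
  qed simp
  ultimately show ?thesis by simp
qed

section \<open>From pair graphs and closed walks to arc relations\<close>

lemma simple_graph_if_pair_graph: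
  assumes "pair_graph G"
  shows "simple_graph (pverts G) (parcs G)"
proof -
  interpret pair_graph G by fact
  show ?thesis
  proof
    show "(u, u) \<notin> parcs G" for u using no_loops'[of u u] by blast
  qed (auto intro: arcs_symmetric dest: in_arcsD1 in_arcsD2)
qed

lemma (in simple_graph) card_arcs_eq_card_edges:
  "card E = 2 * card ((\<lambda>(u, v). {u, v}) ` E)"
proof -
  let ?f = "\<lambda>(u, v). {u, v}"
  have "card E = (\<Sum>e\<in>?f ` E. card {p \<in> E. ?f p = e})"
    using sum.image_gen[OF finite_E, of "\<lambda>_. 1 :: nat" ?f] by simp
  also have "\<dots> = (\<Sum>e\<in>?f ` E. 2)"
  proof (rule sum.cong[OF refl])
    fix e assume "e \<in> ?f ` E"
    then obtain u v where uv: "(u, v) \<in> E" "e = {u, v}" by auto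
    have "?f p = e \<longleftrightarrow> p = (u, v) \<or> p = (v, u)" for p
      unfolding uv(2) by (cases p) (simp add: doubleton_eq_iff)
    then have "{p \<in> E. ?f p = e} = {p. p = (u, v) \<or> p = (v, u)}"
      using uv(1) sym_arcs[OF uv(1)] by (intro Collect_cong) metis
    also have "\<dots> = {(u, v), (v, u)}" by blast
    finally have "{p \<in> E. ?f p = e} = {(u, v), (v, u)}" .
    moreover have "u \<noteq> v" using uv(1) no_loop by metis
    ultimately show "card {p \<in> E. ?f p = e} = 2" by simp
  qed
  finally show ?thesis by simp
qed

lemma unicyclic_graph_if_unicyclic:
  assumes "unicyclic G"
  shows "unicyclic_graph (pverts G) (parcs G)"
proof -
  have pg: "pair_graph G" and conn: "Digraph_Component.connected (with_proj G)"
    and card: "card (edges G) = card (pverts G)"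
    using assms by (simp_all add: unicyclic_def)
  interpret simple_graph "pverts G" "parcs G" by (rule simple_graph_if_pair_graph[OF pg])
  have sc: "strongly_connected (mk_symmetric (with_proj G))"
    using conn by (simp add: connected_def)
  have "(\<Union>e\<in>parcs G. {(fst e, snd e), (snd e, fst e)}) = parcs G" using sym_arcs by auto
  then have mk: "mk_symmetric (with_proj G) = \<lparr>pverts = pverts G, parcs = parcs G\<rparr>"
    by (simp add: mk_symmetric_def)
  have rtr: "(u, v) \<in> (parcs G)\<^sup>*" if "(u, v) \<in> rtrancl_on (pverts G) (parcs G)" for u v
    using that by induction (auto intro: rtrancl_into_rtrancl)
  show ?thesis
  proof
    show "pverts G \<noteq> {}" using sc by (simp add: strongly_connected_def mk)
    show "(u, v) \<in> (parcs G)\<^sup>*" if "u \<in> pverts G" "v \<in> pverts G" for u v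
      using that sc rtr by (auto simp: strongly_connected_def mk reachable_def)
    show "card (parcs G) = 2 * card (pverts G)"
      using card_arcs_eq_card_edges card by (simp add: edges_def)
  qed
qed

text \<open>
  The heads of the arcs of the closed walk, in order, are the vertices of the cycle.
\<close>

lemma has_cycle_cyclic_seq:
  assumes "has_cycle_of_length G q"
  shows "\<exists>c. cyclic_seq (parcs G) q c"
proof -
  obtain p u where q: "3 \<le> q" "length p = q"
    and walk: "pre_digraph.awalk (with_proj G) u p u"
    and dist: "distinct (tl (pre_digraph.awalk_verts (with_proj G) u p))"
    using assms unfolding has_cycle_of_length_def pre_digraph.cycle_def by blast
  have arcs: "set p \<subseteq> parcs G" and cas: "pcas u p u"
    using walk unfolding pre_digraph.awalk_def cas_with_proj_eq by simp_all
  have verts: "pawalk_verts a es = a # map snd es" if "pcas a es b" for a b and es :: "('a \<times> 'a) list"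
    using that by (induction es arbitrary: a) auto
  have distinct: "distinct (map snd p)"
    using dist verts[OF cas] by (simp add: awalk_verts_with_proj_eq)
  have ends: "fst (es ! 0) = a" "snd (last es) = b" if "pcas a es b" "es \<noteq> []" for a b and es :: "('a \<times> 'a) list"
    using that by (induction es arbitrary: a) auto
  have link: "fst (es ! Suc j) = snd (es ! j)" if "pcas a es b" "Suc j < length es"
    for a b j and es :: "('a \<times> 'a) list"
    using that
  proof (induction es arbitrary: a j)
    case (Cons e es)
    show ?case
    proof (cases j)
      case 0
      then show ?thesis using Cons.prems ends(1)[of "snd e" es b] by auto
    next
      case (Suc i)
      then show ?thesis using Cons by auto
    qed
  qed simp
  define c where "c j = snd (p ! j)" for j
  have "cyclic_seq (parcs G) q c"
    unfolding cyclic_seq_def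
  proof (intro conjI allI impI)
    show "3 \<le> q" by fact
    show "inj_on c {..<q}"
      using distinct q by (auto simp: c_def inj_on_def distinct_conv_nth)
    fix j assume j: "j < q"
    show "(c j, c (Suc j mod q)) \<in> parcs G"
    proof (cases "Suc j = q")
      case True
      have "p \<noteq> []" "length p - 1 = j" using q True by auto
      then have "fst (p ! 0) = snd (p ! j)"
        using ends[OF cas] q \<open>length p - 1 = j\<close> by (simp add: last_conv_nth)
      then have "(c j, c 0) = p ! 0" by (simp add: c_def prod_eq_iff)
      moreover have "p ! 0 \<in> set p" using q by (intro nth_mem) linarith
      ultimately show ?thesis using arcs True by auto
    next
      case False
      then have "(c j, c (Suc j)) = p ! Suc j" using link[OF cas, of j] j q by (simp add: c_def prod_eq_iff)
      moreover have "p ! Suc j \<in> set p" using False j q by (intro nth_mem) linarith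
      ultimately show ?thesis using arcs False j by auto
    qed
  qed
  then show ?thesis by blast
qed

theorem theorem4p3:
  fixes G :: "'a pair_pre_digraph" and n q :: nat
  assumes "unicyclic G"
    and "card (pverts G) = n"
    and "has_cycle_of_length G q"
    and "q < n"
  shows "SLEE (cycle_graph n) < SLEE (pendent_cycle_graph n) \<and>
         SLEE (pendent_cycle_graph n) \<le> SLEE G \<and>
         (SLEE (pendent_cycle_graph n) = SLEE G \<longleftrightarrow> graph_iso G (pendent_cycle_graph n)) \<and>
         (graph_iso G (pendent_cycle_graph n) \<longleftrightarrow> q = n - 1)"
proof -
  let ?V = "pverts G" and ?E = "parcs G" and ?P = "pendent_cycle_graph n"
  interpret unicyclic_graph ?V ?E by (rule unicyclic_graph_if_unicyclic[OF assms(1)])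
  obtain c where c: "cyclic_seq ?E q c" using has_cycle_cyclic_seq[OF assms(3)] by blast
  have q: "3 \<le> q" using c by (simp add: cyclic_seq_def)
  have less: "SLEE (cycle_graph n) < SLEE ?P"
    using SLEE_cycle_graph_less[of "n - 1"] q assms(4) by simp
  have iso_P: "\<exists>f. bij_betw f {..<n} ?V \<and> F = map_prod f f ` parcs ?P"
    if "unicyclic_graph ?V F" "cyclic_seq F k d" "Suc k = n" for F k d
    using unicyclic_graph.long_cycle_iso_pendent_cycle_graph[OF that(1,2)] that(3) assms(2) by metis
  have P: "pverts ?P = {..<n}" "simple_graph (pverts ?P) (parcs ?P)"
    using pendent_cycle_graph_Suc(1)[of "n - 1"] simple_graph_pendent_cycle_graph[of "n - 1"] q assms(4)
    by simp_all
  have leaf: "has_leaf ?E" using short_cycle_has_leaf[OF c] assms(2,4) by simp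
  have G: "\<lparr>pverts = ?V, parcs = ?E\<rparr> = G" by simp
  obtain H where H: "unicyclic_graph ?V H" "short_tadpole ?V H"
    and le: "SLEE \<lparr>pverts = ?V, parcs = H\<rparr> \<le> SLEE G"
    and strict: "\<not> short_tadpole ?V ?E \<Longrightarrow> SLEE \<lparr>pverts = ?V, parcs = H\<rparr> < SLEE G"
    using descend[OF leaf, unfolded G] by blast
  obtain k d where d: "cyclic_seq H k d" using unicyclic_graph.short_tadpole_ex_cycle[OF H] by blast
  have "Suc k = n" using unicyclic_graph.short_tadpole_cycle_length[OF H d] assms(2) by simp
  then obtain f where "bij_betw f {..<n} ?V" "H = map_prod f f ` parcs ?P"
    using iso_P[OF H(1) d] by blast
  then have H_P: "SLEE ?P = SLEE \<lparr>pverts = ?V, parcs = H\<rparr>"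
    using P by (intro SLEE_eq_if_iso) auto
  have iso_imp: "SLEE ?P = SLEE G" if "graph_iso G ?P"
    using graph_isoD[OF that] SLEE_eq_if_iso[OF simple_graph_axioms] by metis
  have eq_imp: "q = n - 1" if "SLEE ?P = SLEE G"
  proof -
    have "short_tadpole ?V ?E" using strict H_P that by auto
    from short_tadpole_cycle_length[OF this c] show ?thesis using assms(2) by linarith
  qed
  have imp_iso: "graph_iso G ?P" if "q = n - 1"
  proof -
    have "Suc q = n" using that assms(4) by simp
    then obtain f where f: "bij_betw f {..<n} ?V" "?E = map_prod f f ` parcs ?P"
      using iso_P[OF unicyclic_graph_axioms c] by blast
    let ?g = "the_inv_into {..<n} f"
    have "?g (f i) = i" if "i < n" for i
      using that f(1) by (intro the_inv_into_f_f) (auto simp: bij_betw_def)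
    then have "map_prod ?g ?g (map_prod f f a) = a" if "a \<in> parcs ?P" for a
      using simple_graph.arcs_subset[OF P(2)] that P(1) by (cases a) auto
    then have "parcs ?P = map_prod ?g ?g ` ?E"
      unfolding f(2) image_image by simp
    then show ?thesis
      using bij_betw_the_inv_into[OF f(1)] P(1) by (intro graph_isoI[OF simple_graph_axioms]) auto
  qed
  show ?thesis using less le H_P iso_imp eq_imp imp_iso by auto
qed

end
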